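(* Let $n\ge1$, let $m:\mathbb R^n\to\mathbb R$ be a bounded measurable function and let $1\le p<\infty$. If there exist $s\in(0,1)$, $c>0$ and $C>0$ such that $e^{itm}\in\mathcal M_p$ and $$\|e^{itm}\|_{\mathcal M_p}\le C e^{c|t|^s}\qquad\text{for all } t\in\mathbb R,$$ then $m\in\mathcal M_p$.
   Context: For a bounded measurable function $m:\mathbb R^n\to\mathbb C$, $T_m$ is the operator defined initially on test functions by $T_mf(x)=\int_{\mathbb R^n}m(\xi)\hat f(\xi)e^{ix\cdot\xi}\,d\xi$, where $\hat f$ is the Fourier transform of $f$ (normalized so that $T_1$ is the identity). For $1\le p<\infty$, $\mathcal M_p=\mathcal M_p(\mathbb R^n)$ is the space of those $m$ for which $T_m$ extends to a bounded operator on $L^p(\mathbb R^n)$, with norm $\|m\|_{\mathcal M_p}=\|T_m\|_{L^p\to L^p}$. *)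

theory Defs
  imports "HOL-Analysis.Analysis"
begin

text \<open>Functions on \<open>\<real>\<^sup>n\<close> are functions on \<^typ>\<open>real ^ 'n\<close>, where \<open>n = CARD('n) \<ge> 1\<close>.\<close>

definition partial_deriv :: "'n \<Rightarrow> (real ^ 'n \<Rightarrow> complex) \<Rightarrow> real ^ 'n \<Rightarrow> complex" where
  "partial_deriv i f = (\<lambda>x. frechet_derivative f (at x) (axis i 1))"

text \<open>\<open>C\<^sup>\<infinity>\<close>: all iterated partial derivatives (the empty list being \<open>f\<close> itself) are
  differentiable everywhere. In particular \<^const>\<open>frechet_derivative\<close>, a choice term, is only
  taken of functions already required to be differentiable.\<close>

definition smooth :: "(real ^ 'n \<Rightarrow> complex) \<Rightarrow> bool" where
  "smooth f \<longleftrightarrow> (\<forall>is. foldr partial_deriv is f differentiable_on UNIV)"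

definition test_functions :: "(real ^ 'n \<Rightarrow> complex) set" where
  "test_functions = {f. smooth f \<and> compact (closure {x. f x \<noteq> 0})}"

text \<open>The factor \<open>(2 \<pi>)\<^sup>-\<^sup>n\<close> sits in the transform, so that the inversion formula holds without
  a constant and the symbol \<open>1\<close> gives the identity.\<close>

definition fourier :: "(real ^ 'n \<Rightarrow> complex) \<Rightarrow> real ^ 'n \<Rightarrow> complex" where
  "fourier f \<xi> = (LINT x|lebesgue. f x * exp (- \<i> * complex_of_real (x \<bullet> \<xi>)))
     / complex_of_real ((2 * pi) ^ CARD('n))"

definition multiplier_op ::
    "(real ^ 'n \<Rightarrow> complex) \<Rightarrow> (real ^ 'n \<Rightarrow> complex) \<Rightarrow> real ^ 'n \<Rightarrow> complex" where
  "multiplier_op m f x =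
     (LINT \<xi>|lebesgue. m \<xi> * fourier f \<xi> * exp (\<i> * complex_of_real (x \<bullet> \<xi>)))"

text \<open>Elements of \<open>L\<^sup>p(\<real>\<^sup>n)\<close> are represented by functions, with equality almost everywhere in
  place of equality. Accordingly an operator on \<open>L\<^sup>p\<close> is a map on representatives that respects
  almost everywhere equality and is complex linear up to it; its values outside \<open>Lp p\<close> are
  irrelevant.\<close>

definition Lp :: "real \<Rightarrow> (real ^ 'n \<Rightarrow> complex) set" where
  "Lp p = {f \<in> borel_measurable lebesgue. integrable lebesgue (\<lambda>x. norm (f x) powr p)}"

definition Lp_norm :: "real \<Rightarrow> (real ^ 'n \<Rightarrow> complex) \<Rightarrow> real" where
  "Lp_norm p f = (LINT x|lebesgue. norm (f x) powr p) powr (1 / p)"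

definition bounded_Lp_op ::
    "real \<Rightarrow> ((real ^ 'n \<Rightarrow> complex) \<Rightarrow> (real ^ 'n \<Rightarrow> complex)) \<Rightarrow> bool" where
  "bounded_Lp_op p T \<longleftrightarrow>
     (\<forall>f\<in>Lp p. T f \<in> Lp p) \<and>
     (\<forall>f\<in>Lp p. \<forall>g\<in>Lp p. (AE x in lebesgue. f x = g x) \<longrightarrow> (AE x in lebesgue. T f x = T g x)) \<and>
     (\<forall>f\<in>Lp p. \<forall>g\<in>Lp p. AE x in lebesgue. T (\<lambda>y. f y + g y) x = T f x + T g x) \<and>
     (\<forall>a. \<forall>f\<in>Lp p. AE x in lebesgue. T (\<lambda>y. a * f y) x = a * T f x) \<and>
     (\<exists>B. \<forall>f\<in>Lp p. Lp_norm p (T f) \<le> B * Lp_norm p f)"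

text \<open>As in \<^const>\<open>onorm\<close>, functions of norm \<open>0\<close> contribute \<open>0 / 0 = 0\<close> to the supremum.\<close>

definition Lp_onorm ::
    "real \<Rightarrow> ((real ^ 'n \<Rightarrow> complex) \<Rightarrow> (real ^ 'n \<Rightarrow> complex)) \<Rightarrow> real" where
  "Lp_onorm p T = (SUP f\<in>Lp p. Lp_norm p (T f) / Lp_norm p f)"

definition multiplier_extension ::
    "real \<Rightarrow> (real ^ 'n \<Rightarrow> complex) \<Rightarrow> ((real ^ 'n \<Rightarrow> complex) \<Rightarrow> (real ^ 'n \<Rightarrow> complex)) \<Rightarrow> bool" where
  "multiplier_extension p m T \<longleftrightarrow>
     bounded_Lp_op p T \<and>
     (\<forall>f\<in>test_functions. AE x in lebesgue. T f x = multiplier_op m f x)"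

definition multiplier_space :: "real \<Rightarrow> (real ^ 'n \<Rightarrow> complex) set" where
  "multiplier_space p =
     {m \<in> borel_measurable lebesgue. bounded (range m) \<and> (\<exists>T. multiplier_extension p m T)}"

text \<open>Test functions are dense in \<open>L\<^sup>p\<close> for \<open>1 \<le> p < \<infinity>\<close>, so the extension is unique up to almost
  everywhere equality and the choice below does not affect the value of the norm.\<close>

definition multiplier_norm :: "real \<Rightarrow> (real ^ 'n \<Rightarrow> complex) \<Rightarrow> real" where
  "multiplier_norm p m = Lp_onorm p (SOME T. multiplier_extension p m T)"

end

theory Submission
  imports Defs "HOL-Probability.Sinc_Integral"
begin

text \<open>
  Let \<open>\<bar>m\<bar> \<le> L\<close>. On \<open>[-L, L]\<close> the identity has a sine series \<open>x = (\<Sum>n. \<beta>\<^sub>n sin (\<tau>\<^sub>n x))\<close> whose coefficients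
  satisfy \<open>(\<Sum>n. \<bar>\<beta>\<^sub>n\<bar> exp (c \<bar>\<tau>\<^sub>n\<bar>\<^sup>s)) < \<infinity>\<close>; this is possible exactly because \<open>s < 1\<close>. Substituting
  \<open>x = m \<xi>\<close> writes \<open>m\<close> as a series of multiples of \<open>exp (\<plusminus> i \<tau>\<^sub>n m)\<close> that converges absolutely in
  the multiplier norm.

  The sine series is that of a triangle wave convolved with the uniform distributions on
  \<open>[-a\<^sub>j, a\<^sub>j]\<close> for all \<open>j\<close>, where \<open>a\<^sub>j = \<delta> / (j + 1)\<^sup>\<sigma>\<close> and \<open>1 < \<sigma> < 1/s\<close>. By symmetry these averages preserve
  the identity on a slightly smaller interval, as \<open>(\<Sum>j. a\<^sub>j) < \<infinity>\<close>, while the coefficient at frequency \<open>k\<close> is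
  multiplied by \<open>(\<Prod>j. sin (a\<^sub>j k) / (a\<^sub>j k)) = O (exp (- const k\<^bsup>1/\<sigma>\<^esup>))\<close>.

  Jensen's inequality for \<open>y \<mapsto> y\<^sup>p\<close>, with weights proportional to the operator bounds, shows that the
  series of operators converges almost everywhere and is bounded on \<open>L\<^sup>p\<close>. Interchanging it with the
  integral defining the multiplier operator requires the Fourier transform of a test function to be integrable.
\<close>

section \<open>Sine series with stretched exponential decay\<close>

text \<open>By the product formula the n-th term contributes
  \<open>sin ((2 n + 2) x) + sin (2 n x)\<close> up to the sign \<open>(-1)^n\<close>, so the sum
  telescopes.\<close>

lemma alternating_odd_sin_sum:
  fixes x :: real
  shows "2 * cos x * (\<Sum>n<N. (-1) ^ n * sin ((2 * real n + 1) * x)) = - ((-1) ^ N * sin (2 * real N * x))"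
proof (induction N)
  case (Suc N)
  have "2 * cos x * sin ((2 * real N + 1) * x) = sin (2 * real (Suc N) * x) + sin (2 * real N * x)"
    using sin_times_cos[of "(2 * real N + 1) * x" x] by (simp add: algebra_simps)
  then show ?case
    using Suc by (simp add: algebra_simps)
qed simp

text \<open>\<open>E y - E 0\<close> is the derivative of the error \<open>S y - e N * y\<close> in
  the next lemma. On \<open>[-1, 1]\<close> the cosine is at least 1/2, which permits division by
  it.\<close>

lemma alternating_odd_cos_sum_diff:
  fixes x :: real
  assumes N: "N > 0" and x: "\<bar>x\<bar> \<le> 1"
  defines "E \<equiv> \<lambda>y. (\<Sum>n<N. (-1) ^ n * cos ((2 * real n + 1) * y) / (2 * real n + 1))"
  shows "\<bar>E x - E 0\<bar> \<le> 2 / N"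
proof -
  \<comment> \<open>The correction cancels the leading term \<open>(-1)\<^sup>N sin (2 N y) / (2 cos y)\<close> of \<open>E'\<close>, leaving \<open>O (1 / N)\<close>.\<close>
  define K where "K y = E y + (-1) ^ N * cos (2 * real N * y) / (4 * real N * cos y)" for y
  have cos_ge: "1/2 \<le> cos y" if "\<bar>y\<bar> \<le> 1" for y :: real
  proof -
    have "cos (pi / 3) \<le> cos \<bar>y\<bar>"
      using that pi_gt3 by (intro cos_monotone_0_pi_le) auto
    then show ?thesis by (simp add: cos_60)
  qed
  have "(K has_real_derivative (-1) ^ N * cos (2 * real N * y) * sin y / (4 * real N * (cos y)\<^sup>2)) (at y)"
    if "\<bar>y\<bar> \<le> 1" for y
  proof -
    have c: "cos y \<noteq> 0" using cos_ge[OF that] by auto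
    have E': "(\<Sum>n<N. (-1) ^ n * sin ((2 * real n + 1) * y)) = - ((-1) ^ N * sin (2 * real N * y)) / (2 * cos y)"
      using alternating_odd_sin_sum[of y N] c by (simp add: field_simps)
    have "(E has_real_derivative (\<Sum>n<N. - ((-1) ^ n * sin ((2 * real n + 1) * y)))) (at y)"
      unfolding E_def by (auto intro!: derivative_eq_intros sum.cong simp: field_simps add_pos_nonneg add_nonneg_eq_0_iff)
    then have "(E has_real_derivative (-1) ^ N * sin (2 * real N * y) / (2 * cos y)) (at y)"
      using E' by (simp add: sum_negf)
    then show ?thesis unfolding K_def
      using c N by (auto intro!: derivative_eq_intros simp: field_simps power2_eq_square)
  qed
  moreover have "norm ((-1) ^ N * cos (2 * real N * y) * sin y / (4 * real N * (cos y)\<^sup>2)) \<le> 1 / N"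
    if "\<bar>y\<bar> \<le> 1" for y
  proof -
    have "(1/2)\<^sup>2 \<le> (cos y)\<^sup>2" by (intro power_mono cos_ge that) auto
    then have "real N \<le> 4 * real N * (cos y)\<^sup>2"
      using N by (simp add: power2_eq_square field_simps)
    moreover have "\<bar>cos (2 * real N * y)\<bar> * \<bar>sin y\<bar> \<le> 1 * 1"
      by (intro mult_mono) auto
    ultimately have "\<bar>cos (2 * real N * y)\<bar> * \<bar>sin y\<bar> / (4 * real N * (cos y)\<^sup>2) \<le> 1 / N"
      using N by (intro frac_le) auto
    then show ?thesis by (simp add: abs_mult power_abs)
  qed
  ultimately have "norm (K x - K 0) \<le> 1 / N * norm (x - 0)"
    using x by (intro field_differentiable_bound[of "{-1..1}" K
      "\<lambda>y. (-1) ^ N * cos (2 * real N * y) * sin y / (4 * real N * (cos y)\<^sup>2)"])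
      (auto intro: has_field_derivative_at_within)
  also have "\<dots> \<le> 1 / N" using x N by (simp add: divide_right_mono)
  finally have 1: "\<bar>K x - K 0\<bar> \<le> 1 / N" by simp
  have 2: "\<bar>(-1) ^ N * cos (2 * real N * y) / (4 * real N * cos y)\<bar> \<le> 1 / (2 * N)" if "\<bar>y\<bar> \<le> 1" for y
  proof -
    have "\<bar>cos (2 * real N * y)\<bar> / (4 * real N * cos y) \<le> 1 / (2 * N)"
      using N cos_ge[OF that] by (intro frac_le) auto
    then show ?thesis using cos_ge[OF that] by (simp add: abs_mult power_abs)
  qed
  \<comment> \<open>The total error is \<open>1 / N\<close> from \<open>K\<close> plus
    \<open>1 / (2 * N)\<close> from the correction at each of \<open>x\<close> and 0.\<close>
  have "1 / real (2 * N) = (1 / N) / 2" by simp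
  then show ?thesis using 1 2[OF x] 2[of 0] unfolding K_def by linarith
qed

text \<open>The sum is the sine series of the triangle wave that equals \<open>x\<close> near 0. Its
  slope at 0 is \<open>4 / pi\<close> times a partial sum of the Leibniz series for
  \<open>pi / 4\<close>, hence tends to 1, and its slope elsewhere on \<open>[-1, 1]\<close> differs
  from that by O(1/N).\<close>

lemma triangle_wave_uniform_limit:
  obtains \<epsilon> :: "nat \<Rightarrow> real" where "\<epsilon> \<longlonglongrightarrow> 0"
    and "\<And>N x. \<bar>x\<bar> \<le> 1 \<Longrightarrow>
      \<bar>(\<Sum>n<N. (4/pi) * (-1) ^ n / (2 * real n + 1)\<^sup>2 * sin ((2 * real n + 1) * x)) - x\<bar> \<le> \<epsilon> N"
proof
  define e where "e N = (\<Sum>n<N. (-1) ^ n / (2 * real n + 1))" for N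
  have "(\<lambda>n. (-1) ^ n / (2 * real n + 1)) sums (pi/4)"
    using pi_series summable_arctan_series[of 1] by (simp add: sums_iff algebra_simps)
  then have e: "e \<longlonglongrightarrow> pi/4"
    unfolding sums_def e_def .
  \<comment> \<open>For \<open>N = 0\<close> the sum is empty and the deviation is
    \<open>|x| \<le> 1\<close>.\<close>
  define \<epsilon> where "\<epsilon> N = (if N = 0 then 1 else 8 / pi / N + \<bar>4 / pi * e N - 1\<bar>)" for N
  have "(\<lambda>N. 8 / pi / real N + \<bar>4 / pi * e N - 1\<bar>) \<longlonglongrightarrow> 0 + \<bar>4 / pi * (pi / 4) - 1\<bar>"
    by (intro tendsto_intros e real_tendsto_divide_at_top filterlim_real_sequentially)
  then have "(\<lambda>N. 8 / pi / real N + \<bar>4 / pi * e N - 1\<bar>) \<longlonglongrightarrow> 0"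
    by simp
  then show "\<epsilon> \<longlonglongrightarrow> 0"
    by (rule Lim_transform_eventually) (auto simp: \<epsilon>_def eventually_sequentially intro!: exI[of _ 1])
  fix N and x :: real assume x: "\<bar>x\<bar> \<le> 1"
  show "\<bar>(\<Sum>n<N. (4/pi) * (-1) ^ n / (2 * real n + 1)\<^sup>2 * sin ((2 * real n + 1) * x)) - x\<bar> \<le> \<epsilon> N"
  proof (cases "N = 0")
    case False
    define E where "E y = (\<Sum>n<N. (-1) ^ n * cos ((2 * real n + 1) * y) / (2 * real n + 1))" for y
    define S where "S y = (\<Sum>n<N. (-1) ^ n / (2 * real n + 1)\<^sup>2 * sin ((2 * real n + 1) * y))" for y
    \<comment> \<open>Since \<open>e N = E 0\<close>, the function \<open>S y - e N * y\<close> has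
      a small derivative, and it vanishes at 0.\<close>
    have "((\<lambda>y. S y - e N * y) has_real_derivative E y - E 0) (at y)" for y
      unfolding S_def E_def e_def
      by (auto intro!: derivative_eq_intros sum.cong simp: field_simps power2_eq_square add_pos_nonneg add_nonneg_eq_0_iff)
    moreover have "norm (E y - E 0) \<le> 2 / N" if "\<bar>y\<bar> \<le> 1" for y
      using alternating_odd_cos_sum_diff[of N y] False that unfolding E_def by simp
    ultimately have "norm ((S x - e N * x) - (S 0 - e N * 0)) \<le> 2 / N * norm (x - 0)"
      using x by (intro field_differentiable_bound[of "{-1..1}" _ "\<lambda>y. E y - E 0"])
        (auto intro: has_field_derivative_at_within)
    also have "\<dots> \<le> 2 / N" using x by (simp add: divide_right_mono)
    finally have 1: "\<bar>S x - e N * x\<bar> \<le> 2 / N" by (simp add: S_def)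
    have "(\<Sum>n<N. (4/pi) * (-1) ^ n / (2 * real n + 1)\<^sup>2 * sin ((2 * real n + 1) * x)) - x
        = 4 / pi * S x - x"
      by (simp add: S_def sum_distrib_left algebra_simps)
    also have "\<dots> = 4 / pi * (S x - e N * x) + (4 / pi * e N - 1) * x"
      by (simp add: algebra_simps)
    also have "\<bar>\<dots>\<bar> \<le> 4 / pi * \<bar>S x - e N * x\<bar> + \<bar>4 / pi * e N - 1\<bar> * \<bar>x\<bar>"
    proof -
      have "\<bar>4 / pi * (S x - e N * x)\<bar> = 4 / pi * \<bar>S x - e N * x\<bar>"
        unfolding abs_mult by simp
      then show ?thesis
        using abs_triangle_ineq[of "4 / pi * (S x - e N * x)" "(4 / pi * e N - 1) * x"]
          abs_mult[of "4 / pi * e N - 1" x] by linarith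
    qed
    also have "\<dots> \<le> 4 / pi * (2 / N) + \<bar>4 / pi * e N - 1\<bar> * 1"
      using x 1 by (intro add_mono mult_left_mono) auto
    finally show ?thesis using False by (simp add: \<epsilon>_def)
  qed (use x in \<open>simp add: \<epsilon>_def\<close>)
qed

section \<open>Averaging and products of sinc factors\<close>

text \<open>Averaging over \<open>[x - a, x + a]\<close> fixes the identity, multiplies
  \<open>sin (k x)\<close> by \<open>sin (a k) / (a k)\<close> and cannot enlarge a uniform error.
  The interval has to stay inside \<open>[-R, R]\<close>, hence the smaller radius.\<close>

lemma sinc_average_deviation:
  fixes \<alpha> k :: "'i \<Rightarrow> real"
  assumes I: "finite I" and k: "\<And>i. i \<in> I \<Longrightarrow> k i \<noteq> 0" and a: "a > 0"
    and dev: "\<And>x. \<bar>x\<bar> \<le> R \<Longrightarrow> \<bar>(\<Sum>i\<in>I. \<alpha> i * sin (k i * x)) - x\<bar> \<le> \<epsilon>"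
    and x: "\<bar>x\<bar> \<le> R - a"
  shows "\<bar>(\<Sum>i\<in>I. \<alpha> i * (sin (a * k i) / (a * k i)) * sin (k i * x)) - x\<bar> \<le> \<epsilon>"
proof -
  \<comment> \<open>The averaged deviation is \<open>(F (x + a) - F (x - a)) / (2 a)\<close> for an antiderivative \<open>F\<close> of the deviation.\<close>
  define F where "F y = - (\<Sum>i\<in>I. \<alpha> i * cos (k i * y) / k i) - y\<^sup>2 / 2" for y
  have F': "(F has_real_derivative (\<Sum>i\<in>I. \<alpha> i * sin (k i * y)) - y) (at y)" for y
    unfolding F_def using k
    by (auto intro!: derivative_eq_intros sum.cong simp: sum_negf[symmetric] simp del: sum_negf)
  have "norm (F (x + a) - F (x - a)) \<le> \<epsilon> * norm (x + a - (x - a))"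
    using x a dev by (intro field_differentiable_bound[of "{-R..R}" F])
      (auto intro: has_field_derivative_at_within F')
  also have "F (x + a) - F (x - a) = 2 * a * ((\<Sum>i\<in>I. \<alpha> i * (sin (a * k i) / (a * k i)) * sin (k i * x)) - x)"
  proof -
    have "\<alpha> i * cos (k i * (x - a)) / k i - \<alpha> i * cos (k i * (x + a)) / k i
        = 2 * a * (\<alpha> i * (sin (a * k i) / (a * k i)) * sin (k i * x))" if "i \<in> I" for i
    proof -
      have "cos (k i * (x - a)) - cos (k i * (x + a)) = 2 * (sin (a * k i) * sin (k i * x))"
        by (simp add: distrib_left right_diff_distrib cos_add cos_diff mult.commute)
      then have "\<alpha> i * (cos (k i * (x - a)) - cos (k i * (x + a))) / k i
          = \<alpha> i * (2 * (sin (a * k i) * sin (k i * x))) / k i"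
        by simp
      then show ?thesis
        using a by (simp add: right_diff_distrib diff_divide_distrib)
    qed
    then have "(\<Sum>i\<in>I. \<alpha> i * cos (k i * (x - a)) / k i) - (\<Sum>i\<in>I. \<alpha> i * cos (k i * (x + a)) / k i)
        = 2 * a * (\<Sum>i\<in>I. \<alpha> i * (sin (a * k i) / (a * k i)) * sin (k i * x))"
      unfolding sum_subtractf[symmetric] sum_distrib_left by (intro sum.cong refl)
    moreover have "(x + a)\<^sup>2 / 2 - (x - a)\<^sup>2 / 2 = 2 * a * x"
      by (simp add: power2_eq_square field_simps)
    ultimately show ?thesis
      unfolding F_def right_diff_distrib by linarith
  qed
  finally show ?thesis using a by (simp add: abs_mult)
qed

text \<open>Every factor has modulus at most 1 and all but finitely many are nonnegative, so the
  partial products converge. The decay comes from the factors with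
  \<open>a j * k \<ge> exp 1\<close>: each has modulus at most \<open>exp (-1)\<close>, and there
  are about \<open>(\<delta> * k / exp 1) powr (1 / \<sigma>)\<close> of them.\<close>

lemma sinc_product_limit:
  fixes \<sigma> \<delta> k :: real and a :: "nat \<Rightarrow> real"
  assumes \<sigma>: "\<sigma> > 1" and \<delta>: "\<delta> > 0" and k: "k > 0"
    and a_def: "\<And>j. a j = \<delta> / real (Suc j) powr \<sigma>"
  shows "\<exists>b. (\<lambda>N. \<Prod>j<N. sin (a j * k) / (a j * k)) \<longlonglongrightarrow> b
    \<and> \<bar>b\<bar> \<le> exp (1 - (\<delta> * k / exp 1) powr (1 / \<sigma>))"
proof -
  define q where "q j = sin (a j * k) / (a j * k)" for j
  define P where "P N = (\<Prod>j<N. q j)" for N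
  have pos: "a j * k > 0" for j
    using \<delta> k by (simp add: a_def)
  have q_le: "\<bar>q j\<bar> \<le> 1" for j
    using abs_sin_x_le_abs_x[of "a j * k"] pos[of j] by (simp add: q_def)
  \<comment> \<open>From \<open>j0\<close> on, \<open>a j * k \<le> 1\<close>, so the sine is
    nonnegative and the tail products decrease.\<close>
  define j0 where "j0 = nat \<lceil>\<delta> * k\<rceil>"
  have q_nonneg: "0 \<le> q j" if "j0 \<le> j" for j
  proof -
    have "real (Suc j) powr 1 \<le> real (Suc j) powr \<sigma>"
      using \<sigma> by (intro powr_mono) auto
    moreover have "\<delta> * k \<le> real (Suc j)"
      using that unfolding j0_def by linarith
    ultimately have "\<delta> * k \<le> real (Suc j) powr \<sigma>"
      by simp
    then have "a j * k \<le> 1"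
      by (simp add: a_def field_simps)
    then have "sin (a j * k) \<ge> 0"
      using pos[of j] pi_gt3 by (intro sin_ge_zero) auto
    then show ?thesis
      using pos[of j] by (simp add: q_def)
  qed
  have "decseq (\<lambda>N. \<Prod>i<N. q (i + j0))"
    using q_le q_nonneg by (intro decseq_SucI) (auto intro!: mult_left_le prod_nonneg simp: abs_le_iff)
  moreover have "0 \<le> (\<Prod>i<N. q (i + j0))" for N
    using q_nonneg by (intro prod_nonneg) auto
  ultimately obtain l where "(\<lambda>N. \<Prod>i<N. q (i + j0)) \<longlonglongrightarrow> l"
    by (metis decseq_convergent)
  then have "(\<lambda>N. P j0 * (\<Prod>i<N. q (i + j0))) \<longlonglongrightarrow> P j0 * l"
    by (rule tendsto_mult_left)
  moreover have "P j0 * (\<Prod>i<N. q (i + j0)) = P (N + j0)" for N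
    by (induction N) (simp_all add: P_def algebra_simps)
  ultimately have lim: "P \<longlonglongrightarrow> P j0 * l"
    using LIMSEQ_offset[of P j0] by simp
  \<comment> \<open>For \<open>j < J\<close> one has \<open>a j * k \<ge> exp 1\<close>. Rounding
    down costs at most a factor \<open>exp 1\<close>, the source of the 1 in the exponent.\<close>
  define J where "J = nat \<lfloor>(\<delta> * k / exp 1) powr (1 / \<sigma>)\<rfloor>"
  have "\<bar>P J\<bar> \<le> (\<Prod>j<J. exp (-1))"
    unfolding P_def abs_prod
  proof (intro prod_mono conjI)
    fix j assume "j \<in> {..<J}"
    then have "real (Suc j) \<le> (\<delta> * k / exp 1) powr (1 / \<sigma>)"
      unfolding J_def by (simp add: nat_less_iff le_nat_floor) linarith
    then have "real (Suc j) powr \<sigma> \<le> ((\<delta> * k / exp 1) powr (1 / \<sigma>)) powr \<sigma>"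
      using \<sigma> by (intro powr_mono2) auto
    also have "\<dots> = \<delta> * k / exp 1"
      using \<sigma> \<delta> k by (simp add: powr_powr)
    finally have "exp 1 \<le> a j * k"
      using \<delta> k by (simp add: a_def field_simps)
    then have "\<bar>sin (a j * k)\<bar> / (a j * k) \<le> 1 / exp 1"
      using pos[of j] by (intro frac_le) auto
    then show "\<bar>q j\<bar> \<le> exp (-1)"
      using pos[of j] by (simp add: q_def exp_minus inverse_eq_divide)
  qed auto
  also have "\<dots> = exp (- real J)"
    by (simp add: exp_of_nat_mult[symmetric])
  also have "\<dots> \<le> exp (1 - (\<delta> * k / exp 1) powr (1 / \<sigma>))"
    unfolding J_def by (simp add: powr_ge_zero) linarith
  finally have "\<bar>P J\<bar> \<le> exp (1 - (\<delta> * k / exp 1) powr (1 / \<sigma>))" .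
  moreover have "\<bar>P (N + J)\<bar> \<le> \<bar>P J\<bar>" for N
    using q_le by (induction N) (auto simp: P_def abs_mult intro: order_trans[OF mult_right_le_one_le])
  ultimately have "\<bar>P (N + J)\<bar> \<le> exp (1 - (\<delta> * k / exp 1) powr (1 / \<sigma>))" for N
    using order_trans by blast
  moreover have "(\<lambda>N. \<bar>P (N + J)\<bar>) \<longlonglongrightarrow> \<bar>P j0 * l\<bar>"
    using LIMSEQ_ignore_initial_segment[OF lim] by (rule tendsto_rabs)
  ultimately have "\<bar>P j0 * l\<bar> \<le> exp (1 - (\<delta> * k / exp 1) powr (1 / \<sigma>))"
    by (intro LIMSEQ_le_const2) auto
  then show ?thesis
    using lim unfolding P_def q_def by blast
qed

lemma stretched_exponential_bounded:
  fixes A B r s :: real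
  assumes "A > 0" "0 < s" "s < r"
  obtains M where "\<And>k. k > 0 \<Longrightarrow> exp (1 - A * k powr r) * exp (B * k powr s) \<le> M"
proof
  fix k :: real assume k: "k > 0"
  \<comment> \<open>At \<open>K\<close> the terms \<open>A * k powr r\<close> and
    \<open>|B| * k powr s\<close> balance. Beyond it the difference to be bounded is at most 0, up
    to it at most \<open>|B| * K powr s\<close>.\<close>
  define K where "K = (\<bar>B\<bar> / A) powr (1 / (r - s))"
  have "B * k powr s - A * k powr r \<le> \<bar>B\<bar> * K powr s"
  proof (cases "k \<le> K")
    case True
    then have "\<bar>B\<bar> * k powr s \<le> \<bar>B\<bar> * K powr s"
      using assms k by (intro mult_left_mono powr_mono2) auto
    moreover have "B * k powr s \<le> \<bar>B\<bar> * k powr s"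
      by (intro mult_right_mono) auto
    moreover have "0 \<le> A * k powr r"
      using assms by simp
    ultimately show ?thesis
      by linarith
  next
    case False
    then have "K powr (r - s) \<le> k powr (r - s)"
      using assms by (intro powr_mono2) (auto simp: K_def)
    then have "\<bar>B\<bar> / A \<le> k powr (r - s)"
      using assms by (simp add: K_def powr_powr)
    then have "B \<le> A * k powr (r - s)"
      using assms by (simp add: field_simps)
    then have "B * k powr s \<le> A * k powr (r - s) * k powr s"
      by (intro mult_right_mono) auto
    also have "\<dots> = A * k powr r"
      by (simp add: powr_add[symmetric])
    finally show ?thesis
      by (smt (verit) mult_nonneg_nonneg powr_ge_zero)
  qed
  then show "exp (1 - A * k powr r) * exp (B * k powr s) \<le> exp (1 + \<bar>B\<bar> * ((\<bar>B\<bar> / A) powr (1 / (r - s))) powr s)"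
    by (simp add: exp_add[symmetric] K_def)
qed

text \<open>The decay exponent \<open>1 / \<sigma>\<close> exceeds \<open>s\<close>, so the sinc
  products absorb the growth \<open>exp (c * |\<tau> n| powr s)\<close>, and the quadratic decay of
  the triangle wave coefficients remains for summability.\<close>

lemma local_identity_sine_series:
  fixes s c L :: real
  assumes s: "0 < s" "s < 1" and L: "L > 0"
  obtains \<beta> \<tau> :: "nat \<Rightarrow> real"
  where "summable (\<lambda>n. \<bar>\<beta> n\<bar> * exp (c * \<bar>\<tau> n\<bar> powr s))"
    and "\<And>x. \<bar>x\<bar> \<le> L \<Longrightarrow> (\<lambda>n. \<beta> n * sin (\<tau> n * x)) sums x"
proof -
  obtain \<sigma> where \<sigma>: "1 < \<sigma>" "\<sigma> < 1 / s"
    using s dense[of 1 "1 / s"] by auto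
  have s_less: "s < 1 / \<sigma>"
    using \<sigma> s by (simp add: field_simps)
  have sum_p: "summable (\<lambda>j. 1 / real (Suc j) powr \<sigma>)"
    using summable_Suc_iff[of "\<lambda>j. real j powr - \<sigma>"] summable_real_powr_iff[of "- \<sigma>"] \<sigma>
    by (simp add: powr_minus_divide)
  define Z where "Z = (\<Sum>j. 1 / real (Suc j) powr \<sigma>)"
  have Z: "Z > 0"
    unfolding Z_def using sum_p by (intro suminf_pos) auto
  \<comment> \<open>The averaging radii then add up to at most 1/2, so half of
    \<open>[-1, 1]\<close> survives all averagings.\<close>
  define \<delta> where "\<delta> = 1 / (2 * Z)"
  have \<delta>: "\<delta> > 0" using Z by (simp add: \<delta>_def)
  define a where "a j = \<delta> / real (Suc j) powr \<sigma>" for j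
  have a_pos: "a j > 0" for j using \<delta> by (simp add: a_def)
  have a_sum: "(\<Sum>j<N. a j) \<le> 1 / 2" for N
  proof -
    have "(\<Sum>j<N. 1 / real (Suc j) powr \<sigma>) \<le> Z"
      unfolding Z_def using sum_p by (intro sum_le_suminf) auto
    then have "\<delta> * (\<Sum>j<N. 1 / real (Suc j) powr \<sigma>) \<le> \<delta> * Z"
      using \<delta> by (intro mult_left_mono) auto
    then show ?thesis
      using Z by (simp add: a_def \<delta>_def sum_distrib_left)
  qed
  define b where "b k = lim (\<lambda>N. \<Prod>j<N. sin (a j * k) / (a j * k))" for k
  have b: "(\<lambda>N. \<Prod>j<N. sin (a j * k) / (a j * k)) \<longlonglongrightarrow> b k"
    and b_le: "\<bar>b k\<bar> \<le> exp (1 - (\<delta> * k / exp 1) powr (1 / \<sigma>))" if "k > 0" for k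
    using sinc_product_limit[OF \<sigma>(1) \<delta> that a_def] unfolding b_def by (auto simp: limI)
  define \<kappa> where "\<kappa> n = 2 * real n + 1" for n
  have \<kappa>: "\<kappa> n > 0" for n by (simp add: \<kappa>_def)
  define \<alpha> where "\<alpha> n = (4/pi) * (-1) ^ n / (\<kappa> n)\<^sup>2" for n
  obtain \<epsilon> where \<epsilon>: "\<epsilon> \<longlonglongrightarrow> 0"
    and dev0: "\<And>M x. \<bar>x\<bar> \<le> 1 \<Longrightarrow> \<bar>(\<Sum>n<M. \<alpha> n * sin (\<kappa> n * x)) - x\<bar> \<le> \<epsilon> M"
    by (rule triangle_wave_uniform_limit[folded \<kappa>_def, folded \<alpha>_def]) blast
  \<comment> \<open>Each averaging is applied on the interval left by the earlier ones. The error
    \<open>\<epsilon> M\<close> does not depend on \<open>N\<close>, which lets \<open>N\<close>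
    tend to infinity first and \<open>M\<close> afterwards.\<close>
  have dev: "\<bar>(\<Sum>n<M. \<alpha> n * (\<Prod>j<N. sin (a j * \<kappa> n) / (a j * \<kappa> n)) * sin (\<kappa> n * x)) - x\<bar> \<le> \<epsilon> M"
    if "\<bar>x\<bar> \<le> 1 - (\<Sum>j<N. a j)" for x M N
    using that
  proof (induction N arbitrary: x)
    case 0
    then show ?case using dev0 by simp
  next
    case (Suc N)
    have "\<bar>(\<Sum>n<M. \<alpha> n * (\<Prod>j<N. sin (a j * \<kappa> n) / (a j * \<kappa> n)) * (sin (a N * \<kappa> n) / (a N * \<kappa> n)) * sin (\<kappa> n * x)) - x\<bar> \<le> \<epsilon> M"
      using \<kappa> a_pos Suc by (intro sinc_average_deviation[where R = "1 - (\<Sum>j<N. a j)"]) (auto simp: less_imp_neq[symmetric])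
    then show ?case by (simp add: mult.assoc)
  qed
  have dev_lim: "\<bar>(\<Sum>n<M. \<alpha> n * b (\<kappa> n) * sin (\<kappa> n * x)) - x\<bar> \<le> \<epsilon> M" if "\<bar>x\<bar> \<le> 1 / 2" for x M
  proof (rule LIMSEQ_le_const2)
    show "(\<lambda>N. \<bar>(\<Sum>n<M. \<alpha> n * (\<Prod>j<N. sin (a j * \<kappa> n) / (a j * \<kappa> n)) * sin (\<kappa> n * x)) - x\<bar>)
      \<longlonglongrightarrow> \<bar>(\<Sum>n<M. \<alpha> n * b (\<kappa> n) * sin (\<kappa> n * x)) - x\<bar>"
      by (intro tendsto_intros b \<kappa>)
    have "\<bar>x\<bar> \<le> 1 - (\<Sum>j<N. a j)" for N
      using that a_sum[of N] by linarith
    then show "\<exists>N0. \<forall>N\<ge>N0. \<bar>(\<Sum>n<M. \<alpha> n * (\<Prod>j<N. sin (a j * \<kappa> n) / (a j * \<kappa> n)) * sin (\<kappa> n * x)) - x\<bar> \<le> \<epsilon> M"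
      using dev by blast
  qed
  have sums: "(\<lambda>n. \<alpha> n * b (\<kappa> n) * sin (\<kappa> n * x)) sums x" if "\<bar>x\<bar> \<le> 1 / 2" for x
    unfolding sums_def
    by (rule LIM_zero_cancel, rule Lim_null_comparison[OF _ \<epsilon>]) (simp add: dev_lim[OF that])
  show ?thesis
  \<comment> \<open>Substituting \<open>x / (2 * L)\<close> and multiplying by \<open>2 * L\<close>
    enlarges the radius from 1/2 to \<open>L\<close>.\<close>
  proof (rule that[of "\<lambda>n. 2 * L * (\<alpha> n * b (\<kappa> n))" "\<lambda>n. \<kappa> n / (2 * L)"])
    fix x assume "\<bar>x\<bar> \<le> L"
    then have "\<bar>x / (2 * L)\<bar> \<le> 1 / 2" using L by (simp add: field_simps)
    from sums_mult[OF sums[OF this], of "2 * L"]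
    show "(\<lambda>n. 2 * L * (\<alpha> n * b (\<kappa> n)) * sin (\<kappa> n / (2 * L) * x)) sums x"
      using L by (simp add: mult.assoc)
  next
    obtain M where M: "\<And>k. k > 0 \<Longrightarrow>
        exp (1 - (\<delta> / exp 1) powr (1/\<sigma>) * k powr (1/\<sigma>)) * exp (c / (2 * L) powr s * k powr s) \<le> M"
      using stretched_exponential_bounded[of "(\<delta> / exp 1) powr (1/\<sigma>)" s "1/\<sigma>" "c / (2 * L) powr s"] \<delta> s s_less
      by (metis divide_pos_pos exp_gt_zero powr_gt_zero less_numeral_extra(3) not_less_iff_gr_or_eq)
    have "\<bar>b (\<kappa> n)\<bar> * exp (c * \<bar>\<kappa> n / (2 * L)\<bar> powr s) \<le> M" for n
    proof -
      have "(\<delta> * \<kappa> n / exp 1) powr (1 / \<sigma>) = (\<delta> / exp 1) powr (1/\<sigma>) * \<kappa> n powr (1/\<sigma>)"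
        using \<delta> \<kappa>[of n] by (simp add: powr_mult[symmetric])
      moreover have "c * \<bar>\<kappa> n / (2 * L)\<bar> powr s = c / (2 * L) powr s * \<kappa> n powr s"
        using L \<kappa>[of n] by (simp add: powr_divide)
      ultimately show ?thesis
        using M[OF \<kappa>[of n]] b_le[OF \<kappa>[of n]] by (smt (verit) exp_gt_zero mult_right_mono)
    qed
    then have "2 * L * \<bar>\<alpha> n\<bar> * (\<bar>b (\<kappa> n)\<bar> * exp (c * \<bar>\<kappa> n / (2 * L)\<bar> powr s)) \<le> 2 * L * \<bar>\<alpha> n\<bar> * M" for n
      using L by (intro mult_left_mono) auto
    note le = this
    \<comment> \<open>The factor \<open>M\<close> is constant in \<open>n\<close>; convergence comes
      from \<open>\<alpha> n = O(1/n^2)\<close>, using \<open>2 n + 1 \<ge> n + 1\<close>.\<close>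
    have dom: "summable (\<lambda>n. 2 * L * \<bar>\<alpha> n\<bar> * M)"
    proof -
      have "summable (\<lambda>n. 1 / (real (Suc n))\<^sup>2)"
        using summable_Suc_iff[of "\<lambda>n. 1 / (real n)\<^sup>2"] inverse_power_summable[of 2, where 'a = real]
        by (simp add: inverse_eq_divide)
      then have "summable (\<lambda>n. 4 / pi * (1 / (real (Suc n))\<^sup>2))"
        by (rule summable_mult)
      then have "summable (\<lambda>n. \<bar>\<alpha> n\<bar>)"
        by (rule summable_comparison_test_ev[rotated])
          (auto simp: \<alpha>_def \<kappa>_def abs_mult power_abs intro!: always_eventually divide_left_mono power_mono mult_left_mono)
      then show ?thesis
        by (intro summable_mult2 summable_mult)
    qed
    have eq: "norm (\<bar>2 * L * (\<alpha> n * b (\<kappa> n))\<bar> * exp (c * \<bar>\<kappa> n / (2 * L)\<bar> powr s))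
        = 2 * L * \<bar>\<alpha> n\<bar> * (\<bar>b (\<kappa> n)\<bar> * exp (c * \<bar>\<kappa> n / (2 * L)\<bar> powr s))" for n
      using L by (simp only: real_norm_def abs_mult abs_abs abs_exp_cancel mult.assoc abs_of_pos)
    show "summable (\<lambda>n. \<bar>2 * L * (\<alpha> n * b (\<kappa> n))\<bar> * exp (c * \<bar>\<kappa> n / (2 * L)\<bar> powr s))"
      by (rule summable_comparison_test'[OF dom, of 0]) (unfold eq, rule le)
  qed
qed

section \<open>Weighted series in Lp\<close>

text \<open>The convex function \<open>y powr p\<close> lies above its tangent at \<open>z\<close>.
  Convexity is applied on the open half-line; at \<open>y = 0\<close> the left side is
  \<open>(1 - p) * z powr p\<close>, which is at most 0.\<close>

lemma powr_tangent_le: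
  fixes p y z :: real
  assumes p: "1 \<le> p" and y: "0 \<le> y" and z: "0 < z"
  shows "z powr p + p * z powr (p - 1) * (y - z) \<le> y powr p"
proof (cases "y = 0")
  case True
  have "p * z powr (p - 1) * (y - z) = - (p * (z powr (p - 1) * z))"
    using True by simp
  also have "z powr (p - 1) * z = z powr p"
    using z powr_add[of z "p - 1" 1] by simp
  finally have "p * z powr (p - 1) * (y - z) = - (p * z powr p)" .
  moreover have "1 * z powr p \<le> p * z powr p"
    using p by (intro mult_right_mono) auto
  ultimately show ?thesis
    using powr_ge_zero[of y p] by linarith
next
  case False
  have "((\<lambda>x. x powr p) has_real_derivative p * z powr (p - 1)) (at z within {0<..})"
    using z has_real_derivative_powr has_field_derivative_at_within by blast
  then have "p * z powr (p - 1) * (y - z) \<le> y powr p - z powr p"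
    using y z False
    by (intro convex_on_imp_above_tangent[OF powr_convex[OF p]]) (auto simp: interior_open)
  then show ?thesis by linarith
qed

text \<open>Jensen's inequality, obtained by summing the tangent inequalities at
  \<open>z = (\<Sum>i\<in>I. w i * y i) / W\<close> with weights \<open>w i\<close>.\<close>

lemma powr_sum_weighted_le:
  fixes p W :: real
  assumes p: "1 \<le> p" and W: "0 < W" and fin: "finite I"
    and w: "\<And>i. i \<in> I \<Longrightarrow> 0 \<le> w i" "sum w I \<le> W" and y: "\<And>i. i \<in> I \<Longrightarrow> 0 \<le> y i"
  shows "(\<Sum>i\<in>I. w i * y i) powr p \<le> W powr (p - 1) * (\<Sum>i\<in>I. w i * y i powr p)"
proof (cases "(\<Sum>i\<in>I. w i * y i) = 0")
  case True
  have "0 \<le> (\<Sum>i\<in>I. w i * y i powr p)"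
    by (intro sum_nonneg mult_nonneg_nonneg w) auto
  then show ?thesis using True by simp
next
  case False
  define z where "z = (\<Sum>i\<in>I. w i * y i) / W"
  have z: "z > 0"
    using False W sum_nonneg[of I "\<lambda>i. w i * y i"] w y by (simp add: z_def order_less_le)
  have Wz: "(\<Sum>i\<in>I. w i * y i) = W * z" using W by (simp add: z_def)
  have zp: "z powr (p - 1) * z = z powr p"
    using z powr_add[of z "p - 1" 1] by simp
  have Wp: "W powr (p - 1) * W = W powr p"
    using W powr_add[of W "p - 1" 1] by simp
  \<comment> \<open>A deficit \<open>W - sum w I\<close> of the total weight only adds a nonnegative
    term, because \<open>p \<ge> 1\<close>.\<close>
  have "W * z powr p \<le> W * z powr p + (p - 1) * (W - sum w I) * z powr p"
    using p w by (simp add: mult_nonneg_nonneg)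
  also have "\<dots> = z powr p * sum w I + p * z powr (p - 1) * (W * z - z * sum w I)"
    unfolding zp[symmetric] by (simp add: algebra_simps)
  also have "\<dots> = (\<Sum>i\<in>I. w i * (z powr p + p * z powr (p - 1) * (y i - z)))"
    unfolding Wz[symmetric] by (simp add: algebra_simps sum.distrib sum_subtractf sum_distrib_left sum_distrib_right)
  also have "\<dots> \<le> (\<Sum>i\<in>I. w i * y i powr p)"
    using w y z p by (intro sum_mono mult_left_mono powr_tangent_le) auto
  finally have "W powr (p - 1) * (W * z powr p) \<le> W powr (p - 1) * (\<Sum>i\<in>I. w i * y i powr p)"
    by (intro mult_left_mono) auto
  moreover have "(W * z) powr p = W powr (p - 1) * (W * z powr p)"
    using W z by (simp add: powr_mult Wp[symmetric])
  ultimately show ?thesis unfolding Wz by simp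
qed

text \<open>By monotone convergence the extended-valued sum has a finite integral, so it is finite
  almost everywhere.\<close>

lemma AE_summable_of_summable_integral:
  fixes f :: "nat \<Rightarrow> 'a \<Rightarrow> real"
  assumes f: "\<And>k. integrable M (f k)" and nonneg: "\<And>k x. 0 \<le> f k x"
    and sum: "summable (\<lambda>k. \<integral>x. f k x \<partial>M)"
  shows "AE x in M. summable (\<lambda>k. f k x)"
proof -
  have [measurable]: "f k \<in> borel_measurable M" for k using f by (rule borel_measurable_integrable)
  have "(\<integral>\<^sup>+x. (\<Sum>k. ennreal (f k x)) \<partial>M) = (\<Sum>k. \<integral>\<^sup>+x. ennreal (f k x) \<partial>M)"
    by (rule nn_integral_suminf) simp
  also have "\<dots> = (\<Sum>k. ennreal (\<integral>x. f k x \<partial>M))"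
    using f nonneg by (simp add: nn_integral_eq_integral)
  also have "\<dots> \<noteq> \<infinity>"
    using sum nonneg by (simp add: ennreal_suminf_neq_top integral_nonneg_AE)
  finally have "AE x in M. (\<Sum>k. ennreal (f k x)) \<noteq> \<infinity>"
    by (intro nn_integral_PInf_AE) auto
  then show ?thesis
    by eventually_elim (use nonneg in \<open>auto intro: summable_suminf_not_top\<close>)
qed

text \<open>This plays the role of Minkowski's inequality for series. Jensen's inequality is applied
  pointwise and then integrated, which gives \<open>W powr (p - 1) * (W * J)\<close>.\<close>

lemma weighted_series_Lp_bound:
  fixes g :: "nat \<Rightarrow> 'a \<Rightarrow> real" and p W J :: real
  assumes p: "1 \<le> p" and W: "0 < W" and w: "\<And>k. 0 \<le> w k" "summable w" "suminf w \<le> W"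
    and g[measurable]: "\<And>k. g k \<in> borel_measurable M" and nonneg: "\<And>k x. 0 \<le> g k x"
    and int: "\<And>k. integrable M (\<lambda>x. g k x powr p)" and J: "\<And>k. (\<integral>x. g k x powr p \<partial>M) \<le> J"
  shows "AE x in M. summable (\<lambda>k. w k * g k x)"
    and "integrable M (\<lambda>x. (\<Sum>k. w k * g k x) powr p)"
    and "(\<integral>x. (\<Sum>k. w k * g k x) powr p \<partial>M) \<le> W powr p * J"
proof -
  define h where "h k x = w k * g k x powr p" for k x
  have h_int: "integrable M (h k)" for k
    unfolding h_def using int by simp
  have h_nonneg: "0 \<le> h k x" for k x
    using w by (simp add: h_def)
  have h_le: "(\<integral>x. h k x \<partial>M) \<le> w k * J" for k
    unfolding h_def using w J by (simp add: mult_left_mono)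
  have h_sum: "summable (\<lambda>k. \<integral>x. h k x \<partial>M)"
    by (rule summable_comparison_test_ev[OF _ summable_mult2[OF w(2), of J]])
      (use h_nonneg h_le in \<open>auto simp: integral_nonneg_AE\<close>)
  have h_AE: "AE x in M. summable (\<lambda>k. h k x)"
    using h_int h_nonneg h_sum by (rule AE_summable_of_summable_integral)
  have J0: "0 \<le> J"
    using J[of 0] by (rule order_trans[rotated]) (simp add: integral_nonneg_AE)
  \<comment> \<open>\<open>H\<close> is the integrable majorant that Jensen's inequality gives for
    the p-th power of the series.\<close>
  define H where "H x = W powr (p - 1) * (\<Sum>k. h k x)" for x
  have H_int: "integrable M H"
    unfolding H_def using h_int h_AE h_sum h_nonneg
    by (intro integrable_mult_right integrable_suminf) auto
  have "(\<integral>x. H x \<partial>M) = W powr (p - 1) * (\<Sum>k. \<integral>x. h k x \<partial>M)"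
    unfolding H_def using h_int h_AE h_sum h_nonneg by (simp add: integral_suminf)
  also have "\<dots> \<le> W powr (p - 1) * (\<Sum>k. w k * J)"
    using h_le h_sum summable_mult2[OF w(2), of J] by (intro mult_left_mono suminf_le) auto
  also have "\<dots> \<le> W powr (p - 1) * (W * J)"
    using w J0 by (intro mult_left_mono) (auto simp: suminf_mult2[symmetric] intro: mult_right_mono)
  also have "\<dots> = W powr p * J"
    using W powr_add[of W "p - 1" 1] by simp
  finally have H_le: "(\<integral>x. H x \<partial>M) \<le> W powr p * J" .
  \<comment> \<open>All partial sums are at most \<open>H x powr (1 / p)\<close>. As the terms are
    nonnegative this gives summability, and the estimate passes to the limit.\<close>
  have bound: "summable (\<lambda>k. w k * g k x) \<and> (\<Sum>k. w k * g k x) powr p \<le> H x"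
    if "summable (\<lambda>k. h k x)" for x
  proof -
    have part: "(\<Sum>k<n. w k * g k x) powr p \<le> H x" for n
    proof -
      have "(\<Sum>k<n. w k * g k x) powr p \<le> W powr (p - 1) * (\<Sum>k<n. h k x)"
        unfolding h_def using w sum_le_suminf[OF w(2), of "{..<n}"] nonneg
        by (intro powr_sum_weighted_le p W) auto
      also have "\<dots> \<le> H x"
        unfolding H_def using that h_nonneg by (intro mult_left_mono sum_le_suminf) auto
      finally show ?thesis .
    qed
    have sum_nn: "0 \<le> (\<Sum>k<n. w k * g k x)" for n
      using w nonneg by (intro sum_nonneg mult_nonneg_nonneg) auto
    have "(\<Sum>k<n. w k * g k x) \<le> H x powr (1 / p)" for n
    proof -
      have "((\<Sum>k<n. w k * g k x) powr p) powr (1 / p) \<le> H x powr (1 / p)"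
        using p part by (intro powr_mono2) auto
      then show ?thesis
        using p sum_nn by (simp add: powr_powr)
    qed
    then have s: "summable (\<lambda>k. w k * g k x)"
      using w nonneg by (intro summableI_nonneg_bounded) auto
    have "(\<lambda>n. (\<Sum>k<n. w k * g k x) powr p) \<longlonglongrightarrow> (\<Sum>k. w k * g k x) powr p"
      using summable_LIMSEQ[OF s] p sum_nn by (intro tendsto_powr') auto
    then have "(\<Sum>k. w k * g k x) powr p \<le> H x"
      using part by (intro LIMSEQ_le_const2) auto
    with s show ?thesis by blast
  qed
  show "AE x in M. summable (\<lambda>k. w k * g k x)"
    using h_AE by eventually_elim (use bound in auto)
  have AE_le: "AE x in M. (\<Sum>k. w k * g k x) powr p \<le> H x"
    using h_AE by eventually_elim (use bound in auto)
  show S: "integrable M (\<lambda>x. (\<Sum>k. w k * g k x) powr p)"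
    by (rule Bochner_Integration.integrable_bound[OF H_int]) (use AE_le in auto)
  show "(\<integral>x. (\<Sum>k. w k * g k x) powr p \<partial>M) \<le> W powr p * J"
    using integral_mono_AE[OF S H_int AE_le] H_le by linarith
qed

section \<open>Fourier transforms of test functions\<close>

lemma test_function_differentiable:
  "f \<in> test_functions \<Longrightarrow> f differentiable (at x)"
  unfolding test_functions_def smooth_def
  by (auto simp: differentiable_on_def dest: spec[of _ "[]"])

lemma test_function_continuous: "f \<in> test_functions \<Longrightarrow> continuous_on S f"
  using test_function_differentiable differentiable_imp_continuous_within continuous_at_imp_continuous_on
  by blast

text \<open>\<open>foldr\<close> applies the last list entry first, so appending \<open>i\<close> to
  an index list expresses derivatives of \<open>partial_deriv i f\<close> as derivatives of
  \<open>f\<close>. On the open complement of its support \<open>f\<close> agrees with 0, so its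
  derivative vanishes there.\<close>

lemma partial_deriv_test_function:
  assumes f: "f \<in> test_functions"
  shows "partial_deriv i f \<in> test_functions"
proof -
  have "foldr partial_deriv is (partial_deriv i f) differentiable_on UNIV" for "is"
    using f by (auto simp: test_functions_def smooth_def dest: spec[of _ "is @ [i]"])
  moreover have "{x. partial_deriv i f x \<noteq> 0} \<subseteq> closure {x. f x \<noteq> 0}"
  proof (rule ccontr)
    assume "\<not> ?thesis"
    then obtain x where x: "partial_deriv i f x \<noteq> 0" "x \<in> - closure {x. f x \<noteq> 0}" by auto
    have "frechet_derivative f (at x) = frechet_derivative (\<lambda>_. 0) (at x)"
      using x(2) closure_subset[of "{x. f x \<noteq> 0}"]
      by (intro frechet_derivative_transform_within_open[where X = "- closure {x. f x \<noteq> 0}"]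
          test_function_differentiable[OF f]) (auto simp: closed_def[symmetric])
    then show False
      using x(1) by (simp add: partial_deriv_def)
  qed
  then have "closure {x. partial_deriv i f x \<noteq> 0} \<subseteq> closure {x. f x \<noteq> 0}"
    by (intro closure_minimal) auto
  then have "compact (closure {x. partial_deriv i f x \<noteq> 0})"
    using f compact_Int_closed[of "closure {x. f x \<noteq> 0}" "closure {x. partial_deriv i f x \<noteq> 0}"]
    by (simp add: test_functions_def Int_absorb1)
  ultimately show ?thesis
    by (simp add: test_functions_def smooth_def)
qed

lemma compact_support_integrable:
  fixes f :: "'a::euclidean_space \<Rightarrow> 'b::{banach, second_countable_topology}"
  assumes "compact (closure {x. f x \<noteq> 0})" "continuous_on UNIV f"
  shows "integrable lborel f"
proof -
  have "indicator (closure {x. f x \<noteq> 0}) x *\<^sub>R f x = f x" for x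
    using closure_subset[of "{x. f x \<noteq> 0}"] by (auto simp: indicator_def)
  then show ?thesis
    using borel_integrable_compact[OF assms(1) continuous_on_subset[OF assms(2)]] by simp
qed

lemma test_function_integrable: "f \<in> test_functions \<Longrightarrow> integrable lborel f"
  using compact_support_integrable test_function_continuous by (auto simp: test_functions_def)

lemma test_function_bounded:
  assumes f: "f \<in> test_functions"
  obtains K where "\<And>x. norm (f x) \<le> K" "0 \<le> K"
proof -
  have "bounded (f ` closure {x. f x \<noteq> 0})"
    using f by (intro compact_imp_bounded compact_continuous_image test_function_continuous[OF f])
      (simp add: test_functions_def)
  then obtain K where K: "\<And>x. x \<in> closure {x. f x \<noteq> 0} \<Longrightarrow> norm (f x) \<le> K"
    unfolding bounded_iff by blast
  have "norm (f x) \<le> max K 0" for x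
    using K[of x] closure_subset[of "{x. f x \<noteq> 0}"] by (cases "f x = 0") (auto simp: le_max_iff_disj)
  then show ?thesis using that[of "max K 0"] by simp
qed

lemma fourier_kernel_continuous:
  "continuous_on S (\<lambda>x. exp (- \<i> * complex_of_real (x \<bullet> \<xi>)))"
  by (intro continuous_intros)

lemma fourier_kernel_norm: "norm (exp (- \<i> * complex_of_real t)) = 1"
  using norm_exp_i_times[of "- t"] by simp

lemma test_function_kernel_integrable:
  assumes "f \<in> test_functions"
  shows "integrable lborel (\<lambda>x. f x * exp (- \<i> * complex_of_real (x \<bullet> \<xi>)))"
proof (rule Bochner_Integration.integrable_bound[OF test_function_integrable[OF assms]])
  show "(\<lambda>x. f x * exp (- \<i> * complex_of_real (x \<bullet> \<xi>))) \<in> borel_measurable lborel"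
    by (simp, intro borel_measurable_continuous_onI continuous_intros test_function_continuous assms)
qed (simp add: norm_mult fourier_kernel_norm del: minus_mult_left)

text \<open>The integrand is Borel measurable, so completing the measure does not change the
  integral. Joint measurability in \<open>x\<close> and \<open>\<xi>\<close> and translation
  invariance are then argued over \<open>lborel\<close>.\<close>

lemma fourier_lborel:
  fixes f :: "real ^ 'n \<Rightarrow> complex"
  assumes "f \<in> test_functions"
  shows "fourier f \<xi> = (\<integral>x. f x * exp (- \<i> * complex_of_real (x \<bullet> \<xi>)) \<partial>lborel) / complex_of_real ((2 * pi) ^ CARD('n))"
  unfolding fourier_def
  using test_function_kernel_integrable[OF assms] by (subst integral_completion) auto

lemma fourier_test_function_measurable:
  fixes f :: "real ^ 'n \<Rightarrow> complex"
  assumes f: "f \<in> test_functions"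
  shows "fourier f \<in> borel_measurable borel"
proof -
  have [measurable]: "f \<in> borel_measurable borel"
    using f by (intro borel_measurable_continuous_onI test_function_continuous)
  have "(\<lambda>\<xi>. (\<integral>x. f x * exp (- \<i> * complex_of_real (x \<bullet> \<xi>)) \<partial>lborel) / complex_of_real ((2 * pi) ^ CARD('n)))
      \<in> borel_measurable borel"
    by (intro borel_measurable_divide lborel.borel_measurable_lebesgue_integral) measurable
  then show ?thesis
    using fourier_lborel[OF f] by (simp add: fun_eq_iff[symmetric] cong: measurable_cong)
qed

lemma fourier_bounded:
  fixes f :: "real ^ 'n \<Rightarrow> complex"
  assumes f: "f \<in> test_functions"
  obtains K where "\<And>\<xi>. norm (fourier f \<xi>) \<le> K"
proof
  fix \<xi>
  have "norm (\<integral>x. f x * exp (- \<i> * complex_of_real (x \<bullet> \<xi>)) \<partial>lborel)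
      \<le> (\<integral>x. norm (f x * exp (- \<i> * complex_of_real (x \<bullet> \<xi>))) \<partial>lborel)"
    by (rule integral_norm_bound)
  also have "\<dots> = (\<integral>x. norm (f x) \<partial>lborel)"
    unfolding norm_mult fourier_kernel_norm by simp
  finally show "norm (fourier f \<xi>) \<le> (\<integral>x. norm (f x) \<partial>lborel) / (2 * pi) ^ CARD('n)"
    by (simp add: fourier_lborel[OF f] norm_divide norm_power norm_mult divide_right_mono)
qed

section \<open>Transforms of derivatives and decay at infinity\<close>

lemma test_function_line_derivative:
  assumes f: "f \<in> test_functions"
  shows "((\<lambda>t. f (x + t *\<^sub>R axis i 1)) has_vector_derivative partial_deriv i f (x + t *\<^sub>R axis i 1)) (at t)"
proof -
  have "((\<lambda>t. x + t *\<^sub>R axis i 1) has_derivative (\<lambda>s. s *\<^sub>R axis i 1)) (at t)"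
    by (auto intro!: derivative_eq_intros)
  moreover have "(f has_derivative frechet_derivative f (at (x + t *\<^sub>R axis i 1))) (at (x + t *\<^sub>R axis i 1))"
    using test_function_differentiable[OF f] by (simp add: frechet_derivative_works)
  ultimately have "((\<lambda>t. f (x + t *\<^sub>R axis i 1)) has_derivative
      (\<lambda>s. frechet_derivative f (at (x + t *\<^sub>R axis i 1)) (s *\<^sub>R axis i 1))) (at t)"
    by (rule has_derivative_compose)
  then show ?thesis
    using linear_frechet_derivative[OF test_function_differentiable[OF f]]
    by (simp add: has_vector_derivative_def partial_deriv_def linear_cmul)
qed

lemma has_vector_derivative_imp_quotient:
  assumes "(\<phi> has_vector_derivative D) (at (0::real))"
  shows "((\<lambda>h. (\<phi> h - \<phi> 0) /\<^sub>R h) \<longlongrightarrow> D) (at 0)"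
proof -
  have "((\<lambda>h. ((\<phi> h - \<phi> 0) - h *\<^sub>R D) /\<^sub>R norm h) \<longlongrightarrow> 0) (at 0)"
    using assms by (simp add: has_vector_derivative_def has_derivative_at_within)
  then have "((\<lambda>h. norm ((\<phi> h - \<phi> 0) /\<^sub>R h - D)) \<longlongrightarrow> 0) (at 0)"
  proof (rule Lim_transform_eventually[OF tendsto_norm_zero])
    show "\<forall>\<^sub>F h in at 0. norm (((\<phi> h - \<phi> 0) - h *\<^sub>R D) /\<^sub>R norm h) = norm ((\<phi> h - \<phi> 0) /\<^sub>R h - D)"
    proof (rule eventually_mono[OF eventually_neq_at_within[of 0]])
      fix h :: real assume h: "h \<noteq> 0"
      have "(\<phi> h - \<phi> 0) /\<^sub>R h - D = ((\<phi> h - \<phi> 0) - h *\<^sub>R D) /\<^sub>R h"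
        using h by (simp add: scaleR_diff_right)
      then show "norm (((\<phi> h - \<phi> 0) - h *\<^sub>R D) /\<^sub>R norm h) = norm ((\<phi> h - \<phi> 0) /\<^sub>R h - D)"
        by simp
    qed
  qed
  then show ?thesis
    by (metis LIM_zero_cancel tendsto_norm_zero_cancel)
qed

text \<open>Translation takes the place of integration by parts: shifting \<open>f\<close> by
  \<open>c\<close> multiplies the integral by \<open>cis (c \<bullet> \<xi>)\<close>. Difference
  quotients of \<open>f\<close> converge under the integral to the partial derivative, those of the
  phase to \<open>\<i> * \<xi> $ i\<close>.\<close>

lemma fourier_partial_deriv:
  fixes f :: "real ^ 'n \<Rightarrow> complex"
  assumes f: "f \<in> test_functions"
  shows "fourier (partial_deriv i f) \<xi> = \<i> * complex_of_real (\<xi> $ i) * fourier f \<xi>"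
proof -
  define e where "e = (axis i 1 :: real ^ 'n)"
  define E where "E x = exp (- \<i> * complex_of_real (x \<bullet> \<xi>))" for x
  define h where "h n = 1 / real (Suc n)" for n
  have h_pos: "0 < h n" and h_le: "h n \<le> 1" for n by (auto simp: h_def)
  have h_lim: "filterlim h (at 0) sequentially"
    using LIMSEQ_Suc[OF lim_1_over_n[where 'a = real]] h_pos
    by (auto simp: filterlim_at h_def[abs_def] less_imp_neq[symmetric])
  define D where "D n x = ((f (x + h n *\<^sub>R e) - f x) /\<^sub>R h n) * E x" for n x
  have E_norm: "norm (E x) = 1" for x unfolding E_def by (rule fourier_kernel_norm)
  have E_cont: "continuous_on UNIV E" unfolding E_def by (rule fourier_kernel_continuous)
  have fE: "integrable lborel (\<lambda>x. f x * E x)"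
    unfolding E_def by (rule test_function_kernel_integrable[OF f])
  have shift: "f (x + c) * E x = cis (c \<bullet> \<xi>) * (f (c + x) * E (c + x))" for x c
    by (simp add: E_def cis_conv_exp exp_add[symmetric] inner_add_left algebra_simps)
  have meas: "(\<lambda>x. f x * E x) \<in> borel_measurable borel"
    using fE borel_measurable_integrable by fastforce
  have trans: "integrable lborel (\<lambda>x. f (c + x) * E (c + x))"
    "(\<integral>x. f (c + x) * E (c + x) \<partial>lborel) = (\<integral>x. f x * E x \<partial>lborel)" for c
  proof -
    have "integrable (distr lborel borel ((+) c)) (\<lambda>x. f x * E x)"
      using fE by (simp add: lborel_distr_plus)
    then show "integrable lborel (\<lambda>x. f (c + x) * E (c + x))"
      by (subst (asm) integrable_distr_eq) (use meas in auto)
    have "(\<integral>x. f x * E x \<partial>lborel) = (\<integral>x. f x * E x \<partial>distr lborel borel ((+) c))"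
      by (simp add: lborel_distr_plus)
    also have "\<dots> = (\<integral>x. f (c + x) * E (c + x) \<partial>lborel)"
      by (rule integral_distr) (use meas in auto)
    finally show "(\<integral>x. f (c + x) * E (c + x) \<partial>lborel) = (\<integral>x. f x * E x \<partial>lborel)" ..
  qed
  have int_shift: "integrable lborel (\<lambda>x. f (x + c) * E x)"
    "(\<integral>x. f (x + c) * E x \<partial>lborel) = cis (c \<bullet> \<xi>) * (\<integral>x. f x * E x \<partial>lborel)" for c
    unfolding shift using trans[of c] by simp_all
  have D_eq: "D n x = (f (x + h n *\<^sub>R e) * E x - f x * E x) /\<^sub>R h n" for n x
    by (simp add: D_def algebra_simps)
  have D_int: "(\<integral>x. D n x \<partial>lborel) = ((cis (h n * \<xi> $ i) - 1) /\<^sub>R h n) * (\<integral>x. f x * E x \<partial>lborel)" for n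
    unfolding D_eq using int_shift[of "h n *\<^sub>R e"] fE
    by (simp add: e_def inner_axis' algebra_simps)
  have "((\<lambda>t. cis (t * \<xi> $ i)) has_vector_derivative \<i> * complex_of_real (\<xi> $ i)) (at 0)"
    using exp_scaleR_has_vector_derivative_right[of "\<i> * complex_of_real (\<xi> $ i)" 0 UNIV]
    by (simp add: cis_conv_exp scaleR_conv_of_real mult_ac)
  from filterlim_compose[OF has_vector_derivative_imp_quotient[OF this] h_lim]
  have "(\<lambda>n. ((cis (h n * \<xi> $ i) - 1) /\<^sub>R h n) * (\<integral>x. f x * E x \<partial>lborel))
      \<longlonglongrightarrow> \<i> * complex_of_real (\<xi> $ i) * (\<integral>x. f x * E x \<partial>lborel)"
    by (intro tendsto_mult_right) simp
  moreover have "(\<lambda>n. \<integral>x. D n x \<partial>lborel) \<longlonglongrightarrow> (\<integral>x. partial_deriv i f x * E x \<partial>lborel)"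
  proof -
    obtain K where K: "\<And>x. norm (partial_deriv i f x) \<le> K" "0 \<le> K"
      using test_function_bounded[OF partial_deriv_test_function[OF f]] by blast
    \<comment> \<open>The points from which a shift by some \<open>t\<close> in
      \<open>[0, 1]\<close> along \<open>e\<close> reaches the support. As \<open>h n\<close> lies
      in that range, every \<open>D n\<close> vanishes outside this compact set.\<close>
    define S where "S = (\<lambda>(x, t). x - t *\<^sub>R e) ` (closure {x. f x \<noteq> 0} \<times> {0..1})"
    have "compact S"
      unfolding S_def using f
      by (intro compact_continuous_image compact_Times)
        (auto simp: test_functions_def split_def intro!: continuous_intros)
    \<comment> \<open>The mean value inequality turns the bound on the partial derivative into a
      bound for the difference quotients that is uniform in \<open>n\<close>.\<close>
    have lip: "norm (f (x + t *\<^sub>R e) - f x) \<le> K * t" if "0 < t" for x t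
    proof -
      have "norm (f (x + t *\<^sub>R e) - f (x + 0 *\<^sub>R e)) \<le> K * norm (t - 0)"
      proof (rule differentiable_bound[of UNIV _ "\<lambda>t s. s *\<^sub>R partial_deriv i f (x + t *\<^sub>R e)"])
        show "onorm (\<lambda>s. s *\<^sub>R partial_deriv i f (x + t *\<^sub>R e)) \<le> K" for t
          using K by (intro onorm_le) (simp add: mult.commute[of K] mult_left_mono)
      qed (use test_function_line_derivative[OF f] in \<open>auto simp: e_def has_vector_derivative_def\<close>)
      then show ?thesis using that by simp
    qed
    have D_bound: "norm (D n x) \<le> K * indicator S x" for n x
    proof (cases "x \<in> S")
      case True
      have "norm (D n x) = norm (f (x + h n *\<^sub>R e) - f x) / h n"
        using h_pos[of n] by (simp add: D_def norm_mult E_norm divide_inverse mult.commute)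
      also have "\<dots> \<le> K"
        using lip[OF h_pos[of n], of x] h_pos[of n] by (simp add: field_simps)
      finally show ?thesis using True by simp
    next
      case False
      have "f (x + t *\<^sub>R e) = 0" if "0 \<le> t" "t \<le> 1" for t
      proof -
        have "x + t *\<^sub>R e \<notin> closure {x. f x \<noteq> 0}"
          using False that unfolding S_def by (force simp: image_iff)
        then show ?thesis
          using closure_subset[of "{x. f x \<noteq> 0}"] by auto
      qed
      from this[of 0] this[of "h n"] show ?thesis
        using False h_pos[of n] h_le[of n] by (simp add: D_def)
    qed
    show ?thesis
    proof (rule integral_dominated_convergence)
      have fc: "continuous_on UNIV f" by (rule test_function_continuous[OF f])
      show "(\<lambda>x. partial_deriv i f x * E x) \<in> borel_measurable lborel"
        using test_function_continuous[OF partial_deriv_test_function[OF f]] E_cont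
        by (simp, intro borel_measurable_continuous_onI continuous_intros)
      show "D n \<in> borel_measurable lborel" for n
        unfolding D_def
        by (simp, intro borel_measurable_continuous_onI continuous_intros E_cont continuous_on_compose2[OF fc] fc) auto
      have "integrable lborel (\<lambda>x. indicator S x *\<^sub>R K)"
        using \<open>compact S\<close> by (intro borel_integrable_compact) auto
      then show "integrable lborel (\<lambda>x. K * indicator S x)"
        by (simp add: mult.commute)
      show "AE x in lborel. norm (D n x) \<le> K * indicator S x" for n
        using D_bound by simp
      show "AE x in lborel. (\<lambda>n. D n x) \<longlonglongrightarrow> partial_deriv i f x * E x"
      proof (intro AE_I2)
        fix x
        from filterlim_compose[OF has_vector_derivative_imp_quotient[OF test_function_line_derivative[OF f, of x i 0]] h_lim]
        show "(\<lambda>n. D n x) \<longlonglongrightarrow> partial_deriv i f x * E x"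
          unfolding D_def by (intro tendsto_mult_right) (simp add: e_def)
      qed
    qed
  qed
  ultimately have "(\<integral>x. partial_deriv i f x * E x \<partial>lborel) = \<i> * complex_of_real (\<xi> $ i) * (\<integral>x. f x * E x \<partial>lborel)"
    unfolding D_int using LIMSEQ_unique by blast
  then show ?thesis
    by (simp add: fourier_lborel f partial_deriv_test_function E_def)
qed

text \<open>Two derivatives in direction \<open>j\<close> multiply the modulus of the transform by
  \<open>(\<xi> $ j)^2\<close>, so the factor \<open>1 + (\<xi> $ j)^2\<close> is paid for by adding
  the estimates for \<open>f\<close> and \<open>?g\<close>. Hence the induction keeps
  \<open>f\<close> arbitrary.\<close>

lemma fourier_product_decay:
  fixes f :: "real ^ 'n \<Rightarrow> complex"
  assumes "finite I" "f \<in> test_functions"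
  shows "\<exists>K. \<forall>\<xi>. (\<Prod>i\<in>I. 1 + (\<xi> $ i)\<^sup>2) * norm (fourier f \<xi>) \<le> K"
  using assms
proof (induction I arbitrary: f rule: finite_induct)
  case empty
  then show ?case using fourier_bounded[of f] by auto
next
  case (insert j I)
  let ?g = "partial_deriv j (partial_deriv j f)"
  have "?g \<in> test_functions" using insert.prems by (intro partial_deriv_test_function)
  then obtain K K' where K: "\<And>\<xi>. (\<Prod>i\<in>I. 1 + (\<xi> $ i)\<^sup>2) * norm (fourier f \<xi>) \<le> K"
    and K': "\<And>\<xi>. (\<Prod>i\<in>I. 1 + (\<xi> $ i)\<^sup>2) * norm (fourier ?g \<xi>) \<le> K'"
    using insert.IH insert.prems by metis
  have "norm (fourier ?g \<xi>) = (\<xi> $ j)\<^sup>2 * norm (fourier f \<xi>)" for \<xi>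
    using insert.prems by (simp add: fourier_partial_deriv partial_deriv_test_function norm_mult power2_eq_square)
  then have "(\<Prod>i\<in>insert j I. 1 + (\<xi> $ i)\<^sup>2) * norm (fourier f \<xi>) \<le> K + K'" for \<xi>
    using K[of \<xi>] K'[of \<xi>] insert.hyps by (simp add: algebra_simps)
  then show ?case by blast
qed

text \<open>The integral splits into one factor per coordinate, each the finite integral of
  \<open>1 / (1 + x^2)\<close> over the line.\<close>

lemma integrable_product_weight:
  "integrable lborel (\<lambda>\<xi>::real ^ 'n. \<Prod>i\<in>UNIV. 1 / (1 + (\<xi> $ i)\<^sup>2))"
proof (rule integrableI_nonneg)
  have int1: "integrable lborel (\<lambda>x::real. 1 / (1 + x\<^sup>2))"
    using integrable_inverse_1_plus_square by (simp add: set_integrable_def inverse_eq_divide)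
  have Basis: "(Basis :: (real ^ 'n) set) = (\<lambda>i. axis i 1) ` UNIV"
    by (auto simp: Basis_vec_def)
  have "(\<Prod>b\<in>Basis. ennreal (1 / (1 + (\<xi> \<bullet> b)\<^sup>2))) = ennreal (\<Prod>i\<in>UNIV. 1 / (1 + (\<xi> $ i)\<^sup>2))" for \<xi> :: "real ^ 'n"
    unfolding Basis by (subst prod.reindex) (auto simp: inj_on_def axis_eq_axis inner_axis prod_ennreal)
  then have "(\<integral>\<^sup>+\<xi>. ennreal (\<Prod>i\<in>UNIV. 1 / (1 + (\<xi> $ i)\<^sup>2)) \<partial>(lborel :: (real ^ 'n) measure))
      = (\<integral>\<^sup>+\<xi>. (\<Prod>b\<in>Basis. ennreal (1 / (1 + (\<xi> \<bullet> b)\<^sup>2))) \<partial>(lborel :: (real ^ 'n) measure))"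
    by (simp only:)
  also have "\<dots> = (\<Prod>b\<in>(Basis :: (real ^ 'n) set). \<integral>\<^sup>+x. ennreal (1 / (1 + x\<^sup>2)) \<partial>lborel)"
    by (rule nn_integral_lborel_prod) auto
  also have "\<dots> = (\<Prod>b\<in>(Basis :: (real ^ 'n) set). ennreal (\<integral>x. 1 / (1 + x\<^sup>2) \<partial>lborel))"
    using int1 by (simp add: nn_integral_eq_integral)
  also have "\<dots> < \<infinity>"
    by (simp add: ennreal_power less_top[symmetric])
  finally show "(\<integral>\<^sup>+\<xi>. ennreal (\<Prod>i\<in>UNIV. 1 / (1 + (\<xi> $ i)\<^sup>2)) \<partial>(lborel :: (real ^ 'n) measure)) < \<infinity>" .
qed (auto intro!: prod_nonneg)

text \<open>The decay estimate over all coordinates bounds the transform by a product weight that is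
  integrable in every dimension.\<close>

lemma fourier_test_function_integrable:
  fixes f :: "real ^ 'n \<Rightarrow> complex"
  assumes f: "f \<in> test_functions"
  shows "integrable lebesgue (fourier f)"
proof -
  obtain K where K: "\<And>\<xi>. (\<Prod>i\<in>UNIV. 1 + (\<xi> $ i)\<^sup>2) * norm (fourier f \<xi>) \<le> K"
    using fourier_product_decay[OF finite f] by blast
  have "norm (fourier f \<xi>) \<le> K * (\<Prod>i\<in>UNIV. 1 / (1 + (\<xi> $ i)\<^sup>2))" for \<xi>
  proof -
    have "0 < (\<Prod>i\<in>UNIV. 1 + (\<xi> $ i)\<^sup>2)"
      by (intro prod_pos) (auto intro: add_pos_nonneg)
    then show ?thesis
      using K[of \<xi>] by (simp add: prod_dividef field_simps)
  qed
  then have "integrable lborel (fourier f)"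
    using fourier_test_function_measurable[OF f]
    by (intro Bochner_Integration.integrable_bound[OF integrable_mult_right[OF integrable_product_weight, of K]])
      (auto intro!: AE_I2 order_trans[OF _ abs_ge_self])
  then show ?thesis
    using fourier_test_function_measurable[OF f] by (simp add: integrable_completion)
qed

section \<open>Series of multipliers\<close>

lemma Lp_onorm_bound:
  assumes T: "bounded_Lp_op p T" and f: "f \<in> Lp p"
  shows "Lp_norm p (T f) \<le> Lp_onorm p T * Lp_norm p f"
proof -
  obtain B where B: "\<And>f. f \<in> Lp p \<Longrightarrow> Lp_norm p (T f) \<le> B * Lp_norm p f"
    using T unfolding bounded_Lp_op_def by blast
  have nonneg: "0 \<le> Lp_norm p g" for g :: "real ^ 'a \<Rightarrow> complex"
    by (simp add: Lp_norm_def)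
  have "bdd_above ((\<lambda>f. Lp_norm p (T f) / Lp_norm p f) ` Lp p)"
  proof (rule bdd_aboveI2)
    fix g :: "real ^ 'a \<Rightarrow> complex" assume g: "g \<in> Lp p"
    \<comment> \<open>The maximum with 0 covers functions of norm 0, whose ratio is 0 by
      convention.\<close>
    show "Lp_norm p (T g) / Lp_norm p g \<le> max B 0"
    proof (cases "Lp_norm p g = 0")
      case False
      then have "Lp_norm p g > 0" using nonneg[of g] by linarith
      then have "Lp_norm p (T g) / Lp_norm p g \<le> B" using B[OF g] by (simp add: divide_le_eq)
      then show ?thesis by simp
    qed simp
  qed
  then have "Lp_norm p (T f) / Lp_norm p f \<le> Lp_onorm p T"
    unfolding Lp_onorm_def using f by (rule cSUP_upper2) simp
  show ?thesis
  proof (cases "Lp_norm p f = 0")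
    \<comment> \<open>The ratio carries no information here; the bound with \<open>B\<close> gives
      \<open>Lp_norm p (T f) \<le> 0\<close>.\<close>
    case True
    then show ?thesis using B[OF f] by simp
  next
    case False
    then have "Lp_norm p f > 0" using nonneg[of f] by linarith
    then show ?thesis
      using \<open>Lp_norm p (T f) / Lp_norm p f \<le> Lp_onorm p T\<close> by (simp add: field_simps)
  qed
qed

text \<open>The phase has modulus 1, so the terms are dominated by
  \<open>norm (a k) * B k * norm (fourier f \<xi>)\<close>, and the integrals of these bounds are
  summable. This justifies exchanging sum and integral.\<close>

lemma multiplier_op_suminf:
  fixes f :: "real ^ 'n \<Rightarrow> complex"
  assumes f: "integrable lebesgue (fourier f)"
    and meas[measurable]: "\<And>k. \<mu> k \<in> borel_measurable lebesgue"
    and bound: "\<And>k \<xi>. norm (\<mu> k \<xi>) \<le> B k" and sum: "summable (\<lambda>k. norm (a k) * B k)"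
  shows "multiplier_op (\<lambda>\<xi>. \<Sum>k. a k * \<mu> k \<xi>) f x = (\<Sum>k. a k * multiplier_op (\<mu> k) f x)"
proof -
  define e where "e \<xi> = fourier f \<xi> * exp (\<i> * complex_of_real (x \<bullet> \<xi>))" for \<xi>
  have norm_e: "norm (e \<xi>) = norm (fourier f \<xi>)" for \<xi>
    by (simp add: e_def norm_mult)
  have [measurable]: "fourier f \<in> borel_measurable lebesgue" using f by (rule borel_measurable_integrable)
  have [measurable]: "(\<lambda>\<xi>. exp (\<i> * complex_of_real (x \<bullet> \<xi>))) \<in> borel_measurable lebesgue"
    by (intro measurable_completion borel_measurable_continuous_onI continuous_intros)
      (simp add: continuous_intros)
  have e: "integrable lebesgue e"
    by (rule Bochner_Integration.integrable_bound[OF f]) (auto simp: norm_e, simp add: e_def[abs_def])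
  define F where "F k \<xi> = a k * \<mu> k \<xi> * e \<xi>" for k \<xi>
  have F_le: "norm (F k \<xi>) \<le> norm (a k) * B k * norm (e \<xi>)" for k \<xi>
    unfolding F_def norm_mult using bound by (intro mult_right_mono mult_left_mono) auto
  have [measurable]: "e \<in> borel_measurable lebesgue" using e by (rule borel_measurable_integrable)
  have F_int: "integrable lebesgue (F k)" for k
    by (rule Bochner_Integration.integrable_bound[OF integrable_mult_right[OF integrable_norm[OF e], of "norm (a k) * B k"]])
      (auto simp: F_def[abs_def] intro!: AE_I2 order_trans[OF F_le[unfolded F_def]])
  have sum_a: "summable (\<lambda>k. norm (a k * \<mu> k \<xi>))" for \<xi>
    by (rule summable_comparison_test_ev[OF _ sum]) (intro always_eventually allI, simp add: norm_mult mult_left_mono bound)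
  have F_sum: "summable (\<lambda>k. norm (F k \<xi>))" for \<xi>
    unfolding F_def norm_mult[of _ "e \<xi>"] using sum_a by (rule summable_mult2)
  have "(\<integral>\<xi>. norm (F k \<xi>) \<partial>lebesgue) \<le> norm (a k) * B k * (\<integral>\<xi>. norm (e \<xi>) \<partial>lebesgue)" for k
    unfolding integral_mult_right_zero[symmetric]
    by (intro integral_mono integrable_mult_right integrable_norm F_int e F_le)
  then have "summable (\<lambda>k. \<integral>\<xi>. norm (F k \<xi>) \<partial>lebesgue)"
    by (intro summable_comparison_test'[OF summable_mult2[OF sum, of "\<integral>\<xi>. norm (e \<xi>) \<partial>lebesgue"], of 0])
      (simp add: integral_nonneg_AE)
  then have "(\<integral>\<xi>. (\<Sum>k. F k \<xi>) \<partial>lebesgue) = (\<Sum>k. \<integral>\<xi>. F k \<xi> \<partial>lebesgue)"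
    using F_int F_sum by (intro integral_suminf) auto
  moreover have "(\<Sum>k. F k \<xi>) = (\<Sum>k. a k * \<mu> k \<xi>) * e \<xi>" for \<xi>
    unfolding F_def by (rule suminf_mult2[symmetric, OF summable_norm_cancel[OF sum_a]])
  ultimately show ?thesis
    by (simp add: multiplier_op_def F_def e_def mult.assoc)
qed

text \<open>The numbers \<open>B k\<close> have two tasks: bounding the multiplier norms they
  control the series of operators, and bounding the suprema they permit the exchange of the series
  with the multiplier integral.\<close>

lemma multiplier_space_suminf:
  fixes \<mu> :: "nat \<Rightarrow> real ^ 'n \<Rightarrow> complex"
  assumes p: "1 \<le> p" and \<mu>: "\<And>k. \<mu> k \<in> multiplier_space p"
    and norm_le: "\<And>k. multiplier_norm p (\<mu> k) \<le> B k"
    and bound: "\<And>k \<xi>. norm (\<mu> k \<xi>) \<le> B k" and B: "\<And>k. 0 < B k"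
    and sum: "summable (\<lambda>k. norm (a k) * B k)"
  shows "(\<lambda>\<xi>. \<Sum>k. a k * \<mu> k \<xi>) \<in> multiplier_space p"
proof -
  have meas[measurable]: "\<mu> k \<in> borel_measurable lebesgue" for k
    using \<mu> by (simp add: multiplier_space_def)
  \<comment> \<open>\<open>multiplier_norm\<close> makes the same choice, so \<open>T k\<close> has
    operator norm \<open>multiplier_norm p (\<mu> k)\<close>.\<close>
  define T where "T k = (SOME T. multiplier_extension p (\<mu> k) T)" for k
  have ext: "multiplier_extension p (\<mu> k) (T k)" for k
    unfolding T_def using \<mu>[of k] by (intro someI_ex[of "multiplier_extension p (\<mu> k)"]) (simp add: multiplier_space_def)
  have bdd: "bounded_Lp_op p (T k)" for k
    using ext by (simp add: multiplier_extension_def)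
  \<comment> \<open>For \<open>f\<close> in \<open>Lp p\<close> the series converges almost
    everywhere; elsewhere the value of the sum is arbitrary.\<close>
  define S where "S f x = (\<Sum>k. a k * T k f x)" for f x
  \<comment> \<open>The added 1 keeps \<open>W\<close> positive even when all coefficients
    vanish.\<close>
  define W where "W = (\<Sum>k. norm (a k) * B k) + 1"
  have "0 \<le> (\<Sum>k. norm (a k) * B k)"
    using sum B by (intro suminf_nonneg) (simp_all add: less_imp_le)
  then have W: "W > 0" by (simp add: W_def)
  have T_Lp: "T k f \<in> Lp p" if "f \<in> Lp p" for k f
    using bdd that by (simp add: bounded_Lp_op_def)
  have main: "(AE x in lebesgue. summable (\<lambda>k. norm (a k * T k f x)))
      \<and> S f \<in> Lp p \<and> Lp_norm p (S f) \<le> W * Lp_norm p f" if f: "f \<in> Lp p" for f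
  proof -
    define J where "J = (\<integral>x. norm (f x) powr p \<partial>lebesgue)"
    have J: "0 \<le> J" by (simp add: J_def integral_nonneg_AE)
    have Tmeas[measurable]: "T k f \<in> borel_measurable lebesgue"
      and Tint: "integrable lebesgue (\<lambda>x. norm (T k f x) powr p)" for k
      using T_Lp[OF f] by (auto simp: Lp_def)
    \<comment> \<open>Dividing by \<open>B k\<close> gives all \<open>g k x powr p\<close> the same
      integral bound \<open>J\<close>; the factor \<open>B k\<close> moves into the weights.\<close>
    define g where "g k x = norm (T k f x) / B k" for k x
    have g_powr: "g k x powr p = norm (T k f x) powr p / B k powr p" for k x
      using B[of k] by (simp add: g_def powr_divide)
    have gJ: "(\<integral>x. g k x powr p \<partial>lebesgue) \<le> J" for k
    proof -
      let ?I = "\<integral>x. norm (T k f x) powr p \<partial>lebesgue"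
      have I: "0 \<le> ?I" by (simp add: integral_nonneg_AE)
      have "Lp_norm p (T k f) \<le> multiplier_norm p (\<mu> k) * Lp_norm p f"
        using Lp_onorm_bound[OF bdd f, of k] by (simp add: multiplier_norm_def T_def)
      also have "\<dots> \<le> B k * Lp_norm p f"
        using norm_le by (intro mult_right_mono) (auto simp: Lp_norm_def)
      finally have "?I powr (1 / p) \<le> B k * J powr (1 / p)"
        by (simp add: Lp_norm_def J_def)
      then have "(?I powr (1 / p)) powr p \<le> (B k * J powr (1 / p)) powr p"
        using p by (intro powr_mono2) auto
      then have "?I \<le> B k powr p * J"
        using p I J B[of k] by (simp add: powr_powr powr_mult)
      then show ?thesis
        using B[of k] by (simp add: g_powr field_simps)
    qed
    have wg: "norm (a k) * B k * g k x = norm (a k * T k f x)" for k x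
      using B[of k] by (simp add: g_def norm_mult)
    have w_nonneg: "0 \<le> norm (a k) * B k" for k
      using B[of k] by simp
    have w_le: "(\<Sum>k. norm (a k) * B k) \<le> W"
      by (simp add: W_def)
    have g_meas: "g k \<in> borel_measurable lebesgue" for k
      unfolding g_def[abs_def] by measurable
    have g_nonneg: "0 \<le> g k x" for k x
      using B[of k] by (simp add: g_def)
    have g_int: "integrable lebesgue (\<lambda>x. g k x powr p)" for k
      unfolding g_powr using Tint by simp
    note bnd = weighted_series_Lp_bound[where g = g and w = "\<lambda>k. norm (a k) * B k", OF p W w_nonneg sum w_le g_meas g_nonneg g_int gJ, unfolded wg]
    note sum_AE = bnd(1) and int = bnd(2) and le = bnd(3)
    have Sf_meas[measurable]: "S f \<in> borel_measurable lebesgue"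
      unfolding S_def[abs_def] by measurable
    have S_le: "AE x in lebesgue. norm (S f x) powr p \<le> (\<Sum>k. norm (a k * T k f x)) powr p"
      using sum_AE by eventually_elim (use p in \<open>auto simp: S_def intro!: powr_mono2 summable_norm\<close>)
    have S_int: "integrable lebesgue (\<lambda>x. norm (S f x) powr p)"
      by (rule Bochner_Integration.integrable_bound[OF int]) (use S_le in auto)
    have "(\<integral>x. norm (S f x) powr p \<partial>lebesgue) \<le> W powr p * J"
      using integral_mono_AE[OF S_int int S_le] le by linarith
    then have "Lp_norm p (S f) \<le> (W powr p * J) powr (1 / p)"
      unfolding Lp_norm_def using p by (intro powr_mono2) (auto simp: integral_nonneg_AE)
    also have "\<dots> = W * Lp_norm p f"
      using W J p by (simp add: powr_mult powr_powr Lp_norm_def J_def)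
    finally show ?thesis
      using sum_AE S_int Sf_meas by (simp add: Lp_def)
  qed
  have sumAE: "AE x in lebesgue. summable (\<lambda>k. a k * T k f x)" if "f \<in> Lp p" for f
    using main[OF that] by (auto elim!: eventually_mono intro: summable_norm_cancel)
  have "bounded_Lp_op p S"
    unfolding bounded_Lp_op_def
  proof (intro conjI ballI impI allI)
    show "S f \<in> Lp p" if "f \<in> Lp p" for f using main that by blast
    show "\<exists>B. \<forall>f\<in>Lp p. Lp_norm p (S f) \<le> B * Lp_norm p f" using main by blast
  next
    fix f g :: "real ^ 'n \<Rightarrow> complex" assume fg: "f \<in> Lp p" "g \<in> Lp p" and eq: "AE x in lebesgue. f x = g x"
    \<comment> \<open>The countably many exceptional sets, one for each \<open>T k\<close>, merge
      into a single null set.\<close>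
    have "AE x in lebesgue. \<forall>k. T k f x = T k g x"
      using bdd fg eq by (simp add: AE_all_countable bounded_Lp_op_def)
    then show "AE x in lebesgue. S f x = S g x"
      by eventually_elim (simp add: S_def)
  next
    fix f g :: "real ^ 'n \<Rightarrow> complex" assume fg: "f \<in> Lp p" "g \<in> Lp p"
    have "AE x in lebesgue. \<forall>k. T k (\<lambda>y. f y + g y) x = T k f x + T k g x"
      using bdd fg by (simp add: AE_all_countable bounded_Lp_op_def)
    then show "AE x in lebesgue. S (\<lambda>y. f y + g y) x = S f x + S g x"
      using sumAE[OF fg(1)] sumAE[OF fg(2)]
      by eventually_elim (simp add: S_def distrib_left suminf_add)
  next
    fix c and f :: "real ^ 'n \<Rightarrow> complex" assume f: "f \<in> Lp p"
    have "AE x in lebesgue. \<forall>k. T k (\<lambda>y. c * f y) x = c * T k f x"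
      using bdd f by (simp add: AE_all_countable bounded_Lp_op_def)
    then show "AE x in lebesgue. S (\<lambda>y. c * f y) x = c * S f x"
      using sumAE[OF f]
      by eventually_elim (simp add: S_def suminf_mult[symmetric] mult.left_commute)
  qed
  moreover have "AE x in lebesgue. S f x = multiplier_op (\<lambda>\<xi>. \<Sum>k. a k * \<mu> k \<xi>) f x"
    if f: "f \<in> test_functions" for f
  proof -
    have "AE x in lebesgue. \<forall>k. T k f x = multiplier_op (\<mu> k) f x"
      using ext f by (simp add: AE_all_countable multiplier_extension_def)
    then show ?thesis
      by eventually_elim (simp add: S_def multiplier_op_suminf[OF fourier_test_function_integrable[OF f] meas bound sum])
  qed
  moreover have "bounded (range (\<lambda>\<xi>. \<Sum>k. a k * \<mu> k \<xi>))"
  proof (rule boundedI)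
    fix z assume "z \<in> range (\<lambda>\<xi>. \<Sum>k. a k * \<mu> k \<xi>)"
    then obtain \<xi> where z: "z = (\<Sum>k. a k * \<mu> k \<xi>)" by blast
    show "norm z \<le> (\<Sum>k. norm (a k) * B k)"
      unfolding z by (rule norm_suminf_le[OF _ sum]) (simp add: norm_mult mult_left_mono bound)
  qed
  ultimately show ?thesis
    by (auto simp: multiplier_space_def multiplier_extension_def)
qed

text \<open>A sum of two multipliers is a series with two nonzero coefficients. The constant bound
  \<open>B\<close> includes 1 so as to be positive.\<close>

lemma multiplier_space_add:
  fixes m\<^sub>1 m\<^sub>2 :: "real ^ 'n \<Rightarrow> complex"
  assumes p: "1 \<le> p" and m: "m\<^sub>1 \<in> multiplier_space p" "m\<^sub>2 \<in> multiplier_space p"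
  shows "(\<lambda>\<xi>. m\<^sub>1 \<xi> + m\<^sub>2 \<xi>) \<in> multiplier_space p"
proof -
  define \<mu> where "\<mu> k = (if k = 0 then m\<^sub>1 else m\<^sub>2)" for k :: nat
  define a where "a k = (if k < 2 then 1 else 0 :: complex)" for k :: nat
  obtain K\<^sub>1 K\<^sub>2 where K: "\<And>\<xi>. norm (m\<^sub>1 \<xi>) \<le> K\<^sub>1" "\<And>\<xi>. norm (m\<^sub>2 \<xi>) \<le> K\<^sub>2"
    using m by (auto simp: multiplier_space_def bounded_iff)
  define B where "B = Max {1, K\<^sub>1, K\<^sub>2, multiplier_norm p m\<^sub>1, multiplier_norm p m\<^sub>2}"
  have B: "1 \<le> B" "K\<^sub>1 \<le> B" "K\<^sub>2 \<le> B" "multiplier_norm p m\<^sub>1 \<le> B" "multiplier_norm p m\<^sub>2 \<le> B"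
    by (auto simp: B_def intro!: Max_ge)
  have "(\<lambda>\<xi>. \<Sum>k. a k * \<mu> k \<xi>) \<in> multiplier_space p"
  proof (rule multiplier_space_suminf[where B = "\<lambda>_. B", OF p])
    show "\<mu> k \<in> multiplier_space p" "multiplier_norm p (\<mu> k) \<le> B" "0 < B" for k
      using m B by (auto simp: \<mu>_def)
    show "norm (\<mu> k \<xi>) \<le> B" for k \<xi>
      using K[of \<xi>] B by (auto simp: \<mu>_def)
    show "summable (\<lambda>k. norm (a k) * B)"
      by (rule summable_finite[of "{..<2}"]) (auto simp: a_def)
  qed
  moreover have "(\<Sum>k. a k * \<mu> k \<xi>) = m\<^sub>1 \<xi> + m\<^sub>2 \<xi>" for \<xi>
  proof -
    have "(\<Sum>k. a k * \<mu> k \<xi>) = (\<Sum>k\<in>{0, 1}. a k * \<mu> k \<xi>)"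
      by (rule suminf_finite) (auto simp: a_def)
    then show ?thesis by (simp add: a_def \<mu>_def)
  qed
  ultimately show ?thesis by simp
qed

section \<open>The sine series evaluated at the values of \<open>m\<close>\<close>

theorem theorem1p2:
  fixes m :: "real ^ 'n \<Rightarrow> real" and p :: real
  assumes "m \<in> borel_measurable lebesgue" and "bounded (range m)" and "1 \<le> p"
    and "\<exists>s c C. 0 < s \<and> s < 1 \<and> 0 < c \<and> 0 < C \<and>
      (\<forall>t::real.
        (\<lambda>\<xi>. exp (\<i> * complex_of_real (t * m \<xi>))) \<in> multiplier_space p \<and>
        multiplier_norm p (\<lambda>\<xi>. exp (\<i> * complex_of_real (t * m \<xi>))) \<le> C * exp (c * \<bar>t\<bar> powr s))"
  shows "(\<lambda>\<xi>. complex_of_real (m \<xi>)) \<in> multiplier_space p"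
proof -
  define e where "e t \<xi> = exp (\<i> * complex_of_real (t * m \<xi>))" for t \<xi>
  obtain s c C where s: "0 < s" "s < 1" and c: "0 < c" and C: "0 < C"
    and e: "\<And>t. e t \<in> multiplier_space p" "\<And>t. multiplier_norm p (e t) \<le> C * exp (c * \<bar>t\<bar> powr s)"
    using assms(4) unfolding e_def[abs_def] by blast
  obtain L where L: "L > 0" "\<And>\<xi>. \<bar>m \<xi>\<bar> \<le> L"
    using \<open>bounded (range m)\<close> unfolding bounded_pos by auto
  obtain \<beta> \<tau> where sum: "summable (\<lambda>n. \<bar>\<beta> n\<bar> * exp (c * \<bar>\<tau> n\<bar> powr s))"
    and id: "\<And>x. \<bar>x\<bar> \<le> L \<Longrightarrow> (\<lambda>n. \<beta> n * sin (\<tau> n * x)) sums x"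
    using local_identity_sine_series[OF s L(1)] by blast
  have norm_e: "norm (e t \<xi>) = 1" for t \<xi>
    by (simp add: e_def)
  \<comment> \<open>Prescribing only the moduli of coefficients and frequencies covers both halves
    of the sine, with \<open>a\<close>, \<open>\<tau>\<close> and with their negatives.\<close>
  have in_Mp: "(\<lambda>\<xi>. \<Sum>n. a n * e (\<theta> n) \<xi>) \<in> multiplier_space p"
    and summable_e: "summable (\<lambda>n. a n * e (\<theta> n) \<xi>)"
    if a: "\<And>n. norm (a n) = \<bar>\<beta> n\<bar> / 2" and \<theta>: "\<And>n. \<bar>\<theta> n\<bar> = \<bar>\<tau> n\<bar>" for a \<theta> \<xi>
  proof -
    \<comment> \<open>\<open>max C 1\<close> ensures \<open>B n \<ge> 1\<close>, so that
      \<open>B n\<close> bounds the modulus 1 of the exponential as well as its multiplier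
      norm.\<close>
    define B where "B n = max C 1 * exp (c * \<bar>\<theta> n\<bar> powr s)" for n
    have B_ge: "1 \<le> B n" for n
      using c mult_mono[of 1 "max C 1" 1 "exp (c * \<bar>\<theta> n\<bar> powr s)"] by (simp add: B_def)
    have "(\<lambda>n. norm (a n) * B n) = (\<lambda>n. max C 1 / 2 * (\<bar>\<beta> n\<bar> * exp (c * \<bar>\<tau> n\<bar> powr s)))"
      by (simp add: a \<theta> B_def mult_ac)
    then have sumB: "summable (\<lambda>n. norm (a n) * B n)"
      using summable_mult[OF sum] by simp
    show "(\<lambda>\<xi>. \<Sum>n. a n * e (\<theta> n) \<xi>) \<in> multiplier_space p"
    proof (rule multiplier_space_suminf[where B = B, OF \<open>1 \<le> p\<close> e(1) _ _ _ sumB])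
      have "C * exp (c * \<bar>\<theta> n\<bar> powr s) \<le> B n" for n
        by (simp add: B_def)
      then show "multiplier_norm p (e (\<theta> n)) \<le> B n" for n
        using e(2) order_trans by blast
      show "norm (e (\<theta> n) \<xi>) \<le> B n" "0 < B n" for n \<xi>
        using B_ge[of n] by (simp_all add: norm_e)
    qed
    have "norm (a n * e (\<theta> n) \<xi>) \<le> norm (a n) * B n" for n
      using mult_left_mono[OF B_ge[of n], of "norm (a n)"] by (simp add: norm_mult norm_e)
    then show "summable (\<lambda>n. a n * e (\<theta> n) \<xi>)"
      by (rule summable_comparison_test'[OF sumB, of 0])
  qed
  \<comment> \<open>The coefficient in
    \<open>sin y = (exp (i y) - exp (- i y)) / (2 i)\<close>.\<close>
  define a where "a n = complex_of_real (\<beta> n) / (2 * \<i>)" for n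
  have norm_a: "norm (a n) = \<bar>\<beta> n\<bar> / 2" "norm (- a n) = \<bar>\<beta> n\<bar> / 2" for n
    by (simp_all add: a_def norm_divide norm_mult)
  have eq: "complex_of_real (m \<xi>) = (\<Sum>n. a n * e (\<tau> n) \<xi>) + (\<Sum>n. - a n * e (- \<tau> n) \<xi>)" for \<xi>
  proof -
    have "complex_of_real (\<beta> n * sin (\<tau> n * m \<xi>)) = a n * e (\<tau> n) \<xi> + - a n * e (- \<tau> n) \<xi>" for n
      by (simp add: a_def e_def sin_of_real[symmetric] sin_exp_eq field_simps)
    moreover have "(\<lambda>n. complex_of_real (\<beta> n * sin (\<tau> n * m \<xi>))) sums complex_of_real (m \<xi>)"
      by (intro sums_of_real id L(2))
    ultimately have "(\<lambda>n. a n * e (\<tau> n) \<xi> + - a n * e (- \<tau> n) \<xi>) sums complex_of_real (m \<xi>)"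
      by simp
    \<comment> \<open>Each half is summable by itself, so the combined series may be split.\<close>
    then show ?thesis
      using suminf_add[OF summable_e[of a \<tau> \<xi>] summable_e[of "\<lambda>n. - a n" "\<lambda>n. - \<tau> n" \<xi>]]
      by (simp add: norm_a sums_iff)
  qed
  show ?thesis
    unfolding eq using norm_a
    by (intro multiplier_space_add in_Mp \<open>1 \<le> p\<close>) auto
qed

end
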